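(* Consider the external field $V(x)=\frac{\gamma}{\alpha}\|x\|^{\alpha}$ with $\gamma>0$ and $\alpha>\max\{-s,0\}$. Suppose that $s\in(-\infty,d)$, $s\ne0$. Then: (1) The energy $I_s$ is minimized over $\mathcal{P}_{\alpha,1}(\mathbb{R}^d)$ by $\nu$ if and only if $\mu=(c\,\mathrm{Id})_{\#}\nu$ minimizes $I_{s,V}$ over $\mathcal{P}(\mathbb{R}^d)$, with $c=\big(\frac{s I_s(\nu)}{2\gamma}\big)^{\frac{1}{s+\alpha}}$. (2) The energy $I_{s,V}$ is minimized over $\mathcal{P}(\mathbb{R}^d)$ by $\mu$ if and only if $\nu=(c^{-1}\,\mathrm{Id})_{\#}\mu$ minimizes $I_s$ over $\mathcal{P}_{\alpha,1}(\mathbb{R}^d)$, with $c=\big(\int_{\mathbb{R}^d}\|x\|^{\alpha}\,\mathrm{d}\mu(x)\big)^{\frac1\alpha}$. Suppose instead that $s=0$ and $\alpha>0$. Then: (3) The energy $I_0$ is minimized over $\mathcal{P}_{\alpha,1}(\mathbb{R}^d)$ by $\nu$ if and only if $\mu=(c\,\mathrm{Id})_{\#}\nu$ minimizes $I_{0,V}$ over $\mathcal{P}(\mathbb{R}^d)$, with $c=\big(\frac{1}{2\gamma}\big)^{\frac1\alpha}$. (4) The energy $I_{0,V}$ is minimized over $\mathcal{P}(\mathbb{R}^d)$ by $\mu$ if and only if $\nu=(c^{-1}\,\mathrm{Id})_{\#}\mu$ minimizes $I_0$ over $\mathcal{P}_{\alpha,1}(\mathbb{R}^d)$, with $c=\b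ig(\int_{\mathbb{R}^d}\|x\|^{\alpha}\,\mathrm{d}\mu(x)\big)^{\frac1\alpha}$.
   Context: $d\ge2$ is an integer. $\|\cdot\|$ is the Euclidean norm on $\mathbb{R}^d$, and $\mathcal{P}(\mathbb{R}^d)$ is the set of probability measures on $\mathbb{R}^d$. The Riesz kernel is $K_s(x)=\frac{1}{s\|x\|^s}$ if $s\ne0$ and $K_0(x)=-\log\|x\|$. The energy of $\mu\in\mathcal{P}(\mathbb{R}^d)$ is $$I_{s,V}(\mu)=\iint\big(K_s(x-y)+V(x)+V(y)\big)\,\mathrm{d}\mu(x)\,\mathrm{d}\mu(y)\in(-\infty,+\infty],$$ and $I_s(\mu)$ denotes this energy with $V\equiv0$, that is, $I_s(\mu)=\iint K_s(x-y)\,\mathrm{d}\mu(x)\,\mathrm{d}\mu(y)$. For $\alpha,c>0$, $\mathcal{P}_{\alpha,c}(\mathbb{R}^d)$ is the set of $\mu\in\mathcal{P}(\mathbb{R}^d)$ with $\int_{\mathbb{R}^d}\|x\|^{\alpha}\,\mathrm{d}\mu(x)=c^{\alpha}$. $\mathrm{Id}$ is the identity map of $\mathbb{R}^d$ and $f_{\#}\mu$ is the pushforward of $\mu$ by a map $f$.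
   Formalization: In (2) and (4) the right side also requires c to equal (s I_s(ν)/(2γ))^{1/(s+α)}, respectively (1/(2γ))^{1/α}; without this "if" fails, since all dilates of μ have the same normalization ν but only one scale minimizes I_{s,V}. *)

theory Defs
  imports "HOL-Probability.Probability"
begin

text \<open>
  For \<open>x \<noteq> 0\<close> this is \<open>1 / (s \<parallel>x\<parallel>\<^sup>s)\<close>, or \<open>- log \<parallel>x\<parallel>\<close> when \<open>s = 0\<close>. The value at the origin
  is the limit there: \<open>\<parallel>0\<parallel>\<^sup>-\<^sup>s / s = 0\<close> for \<open>s < 0\<close>, and \<open>\<infinity>\<close> for \<open>s \<ge> 0\<close>.
\<close>
definition riesz_kernel :: "real \<Rightarrow> 'a::euclidean_space \<Rightarrow> ereal" where
  "riesz_kernel s x =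
     (if x = 0 then (if s < 0 then 0 else \<infinity>)
      else if s = 0 then ereal (- ln (norm x))
      else ereal (1 / (s * norm x powr s)))"

text \<open>
  Integral of an extended real function as the integral of its positive part minus the integral
  of its negative part; \<^const>\<open>e2ennreal\<close> maps negative numbers to \<open>0\<close>. If both parts have
  infinite integral the integral does not exist, and the value below is \<open>\<infinity> - \<infinity> = \<infinity>\<close>.
\<close>
definition ereal_integral :: "'a measure \<Rightarrow> ('a \<Rightarrow> ereal) \<Rightarrow> ereal" where
  "ereal_integral M f =
     enn2ereal (\<integral>\<^sup>+ x. e2ennreal (f x) \<partial>M) - enn2ereal (\<integral>\<^sup>+ x. e2ennreal (- f x) \<partial>M)"

definition riesz_energy_field :: "real \<Rightarrow> ('a::euclidean_space \<Rightarrow> real) \<Rightarrow> 'a measure \<Rightarrow> ereal" where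
  "riesz_energy_field s V \<mu> =
     ereal_integral (\<mu> \<Otimes>\<^sub>M \<mu>) (\<lambda>(x, y). riesz_kernel s (x - y) + ereal (V x) + ereal (V y))"

definition riesz_energy :: "real \<Rightarrow> 'a::euclidean_space measure \<Rightarrow> ereal" where
  "riesz_energy s \<mu> = riesz_energy_field s (\<lambda>_. 0) \<mu>"

definition power_field :: "real \<Rightarrow> real \<Rightarrow> 'a::euclidean_space \<Rightarrow> real" where
  "power_field \<gamma> \<alpha> x = \<gamma> / \<alpha> * norm x powr \<alpha>"

definition prob_measures :: "'a::euclidean_space measure set" where
  "prob_measures = {\<mu>. prob_space \<mu> \<and> sets \<mu> = sets borel}"

definition prob_measures_moment :: "real \<Rightarrow> real \<Rightarrow> 'a::euclidean_space measure set" where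
  "prob_measures_moment \<alpha> c =
     {\<mu> \<in> prob_measures. (\<integral>\<^sup>+ x. ennreal (norm x powr \<alpha>) \<partial>\<mu>) = ennreal (c powr \<alpha>)}"

definition minimizes_over :: "('b \<Rightarrow> ereal) \<Rightarrow> 'b set \<Rightarrow> 'b \<Rightarrow> bool" where
  "minimizes_over E S \<mu> \<longleftrightarrow> is_arg_min E (\<lambda>\<mu>'. \<mu>' \<in> S) \<mu>"

definition dilate :: "real \<Rightarrow> 'a::euclidean_space measure \<Rightarrow> 'a measure" where
  "dilate c \<mu> = distr \<mu> borel (\<lambda>x. c *\<^sub>R x)"

text \<open>
  If the moment is infinite the Bochner integral, and hence the radius, is \<open>0\<close>; the radius is also
  \<open>0\<close> for the Dirac mass at the origin. In both cases \<open>dilate (inverse 0) \<mu>\<close> is the Dirac mass at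
  the origin, which does not have unit moment.

  The normalization \<open>dilate (inverse (moment_radius \<alpha> \<mu>)) \<mu>\<close> is the same for all dilates of \<open>\<mu>\<close>, so
  whether it minimizes the energy under the moment constraint says nothing about the scale of
  \<open>\<mu>\<close>. A characterization of the minimizers \<open>\<mu>\<close> of the energy with external field by means of
  their normalization \<open>\<nu>\<close> has to state in addition that the radius has the value that is
  prescribed by \<open>\<nu>\<close>.
\<close>
definition moment_radius :: "real \<Rightarrow> 'a::euclidean_space measure \<Rightarrow> real" where
  "moment_radius \<alpha> \<mu> = (\<integral>x. norm x powr \<alpha> \<partial>\<mu>) powr (1 / \<alpha>)"

text \<open>
  The scale of the equilibrium problem for the field \<^const>\<open>power_field\<close>, given a minimizer \<open>\<nu>\<close> of
  the energy under the unit moment constraint. If the energy of \<open>\<nu>\<close> is infinite, the scale is \<open>0\<close>.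
\<close>
definition equilibrium_scale :: "real \<Rightarrow> real \<Rightarrow> real \<Rightarrow> 'a::euclidean_space measure \<Rightarrow> real" where
  "equilibrium_scale s \<gamma> \<alpha> \<nu> =
     (s * real_of_ereal (riesz_energy s \<nu>) / (2 * \<gamma>)) powr (1 / (s + \<alpha>))"

end

theory Submission
  imports Defs
begin

text \<open>
  If the moment \<open>m\<close> of \<open>\<mu>\<close> is finite, the energy of \<open>\<mu>\<close> with the external field is
  \<open>I\<^sub>s(\<mu>) + 2 \<gamma> m / \<alpha>\<close>; if \<open>m = \<infinity>\<close>, it is \<open>\<infinity>\<close>, because \<open>K\<^sub>s\<close> is bounded below by
  \<open>- \<epsilon> \<parallel>x\<parallel>\<^sup>\<alpha> - C\<close> for every \<open>\<epsilon> > 0\<close>. A measure with positive finite moment is a dilate by some \<open>t > 0\<close> of a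
  measure \<open>\<nu>\<close> with unit moment, and with \<open>E = I\<^sub>s(\<nu>)\<close> its energy is \<open>t\<^sup>-\<^sup>s E + 2 \<gamma> t\<^sup>\<alpha> / \<alpha>\<close>
  (\<open>E - ln t + 2 \<gamma> t\<^sup>\<alpha> / \<alpha>\<close> if \<open>s = 0\<close>). This increases with \<open>E\<close> for each \<open>t\<close>, and as a function of \<open>t\<close> it
  is minimal exactly when \<open>s E = 2 \<gamma> t\<^sup>s\<^sup>+\<^sup>\<alpha>\<close> (\<open>1 = 2 \<gamma> t\<^sup>\<alpha>\<close>). Conversely, criticality of a
  minimizer with respect to dilations forces the normalization of the moment. The uniform
  distribution on a ball, whose energy is finite for \<open>s < d\<close>, rules out degenerate minimizers.
\<close>

section \<open>The energy with external field\<close>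

abbreviation moment :: "real \<Rightarrow> 'a::euclidean_space measure \<Rightarrow> ennreal" where
  "moment \<alpha> \<mu> \<equiv> (\<integral>\<^sup>+ x. ennreal (norm x powr \<alpha>) \<partial>\<mu>)"

text \<open>The positive part of \<open>f\<close> plus \<open>v\<close> equals the negative part
  plus \<open>u\<close>, and the negative part is at most \<open>v\<close>; integrate and cancel the
  finite integrals. Since \<open>u\<close> and \<open>v\<close> need not be the parts of
  \<open>f\<close> themselves, the field or a constant can be added to the kernel.\<close>

lemma ereal_integral_eq_diff:
  assumes [measurable]: "f \<in> borel_measurable M" "u \<in> borel_measurable M" "v \<in> borel_measurable M"
    and f: "\<And>x. x \<in> space M \<Longrightarrow> f x = enn2ereal (u x) - enn2ereal (v x)"
    and v: "\<And>x. x \<in> space M \<Longrightarrow> v x < \<infinity>" and v_int: "(\<integral>\<^sup>+ x. v x \<partial>M) < \<infinity>"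
  shows "ereal_integral M f = enn2ereal (\<integral>\<^sup>+ x. u x \<partial>M) - enn2ereal (\<integral>\<^sup>+ x. v x \<partial>M)"
proof -
  have swap: "ennreal (r - q) + ennreal q = ennreal (q - r) + ennreal r" if "r \<ge> 0" "q \<ge> 0" for r q
    using that by (cases "r \<le> q") (auto simp: ennreal_plus[symmetric] ennreal_neg simp del: ennreal_plus)
  have pt: "e2ennreal (f x) + v x = e2ennreal (- f x) + u x \<and> e2ennreal (- f x) \<le> v x"
    if "x \<in> space M" for x
    using v[OF that] unfolding f[OF that]
    by (cases "u x"; cases "v x")
      (auto simp: swap e2ennreal_neg intro!: ennreal_leI)
  have "(\<integral>\<^sup>+ x. e2ennreal (f x) \<partial>M) + (\<integral>\<^sup>+ x. v x \<partial>M)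
      = (\<integral>\<^sup>+ x. e2ennreal (- f x) \<partial>M) + (\<integral>\<^sup>+ x. u x \<partial>M)"
    using pt by (subst (1 2) nn_integral_add[symmetric]) (auto intro!: nn_integral_cong)
  moreover have "(\<integral>\<^sup>+ x. e2ennreal (- f x) \<partial>M) \<le> (\<integral>\<^sup>+ x. v x \<partial>M)"
    using pt by (intro nn_integral_mono) auto
  moreover have "enn2ereal P - enn2ereal N = enn2ereal U - enn2ereal W"
    if eq: "P + W = N + U" and le: "N \<le> W" and fin: "W < \<infinity>" for P N U W
  proof -
    obtain w where w: "W = ennreal w" "w \<ge> 0" using fin by (cases W) auto
    obtain n where n: "N = ennreal n" "n \<ge> 0" using le fin by (cases N) (auto simp: w top_unique)
    show ?thesis
      using eq w n by (cases P; cases U) (auto simp: ennreal_plus[symmetric] simp del: ennreal_plus)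
  qed
  ultimately show ?thesis
    using v_int unfolding ereal_integral_def by blast
qed

lemma nn_integral_pair_prob:
  assumes "prob_space M" and [measurable]: "f \<in> borel_measurable M"
  shows "(\<integral>\<^sup>+ z. f (fst z) \<partial>(M \<Otimes>\<^sub>M M)) = (\<integral>\<^sup>+ x. f x \<partial>M)"
    and "(\<integral>\<^sup>+ z. f (snd z) \<partial>(M \<Otimes>\<^sub>M M)) = (\<integral>\<^sup>+ x. f x \<partial>M)"
proof -
  interpret prob_space M by fact
  show "(\<integral>\<^sup>+ z. f (fst z) \<partial>(M \<Otimes>\<^sub>M M)) = (\<integral>\<^sup>+ x. f x \<partial>M)"
    by (subst nn_integral_fst[symmetric]) (auto simp: emeasure_space_1)
  show "(\<integral>\<^sup>+ z. f (snd z) \<partial>(M \<Otimes>\<^sub>M M)) = (\<integral>\<^sup>+ x. f x \<partial>M)"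
    by (subst nn_integral_fst[symmetric]) (auto simp: emeasure_space_1)
qed

section \<open>Growth bounds, scaling and sign of the kernel\<close>

lemma powr_div_le_add_const:
  fixes a p \<alpha> :: real
  assumes "0 < a" "0 < p" "p < \<alpha>"
  obtains C where "C \<ge> 0" "\<And>t. t \<ge> 0 \<Longrightarrow> t powr p / p \<le> a * t powr \<alpha> + C"
proof -
  \<comment> \<open>\<open>T\<close> is the positive solution of
    \<open>T powr p / p = a * T powr \<alpha>\<close>. Beyond it the higher power dominates; up to
    it the left side is at most its value at \<open>T\<close>.\<close>
  define T where "T = (a * p) powr (1 / (p - \<alpha>))"
  have T: "T > 0" and aT: "T powr (p - \<alpha>) = a * p"
    using assms by (auto simp: T_def powr_powr)
  have "t powr p / p \<le> a * t powr \<alpha> + T powr p / p" if t: "t \<ge> 0" for t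
  proof (cases "t \<le> T")
    case True
    then have "t powr p / p \<le> T powr p / p"
      using assms t by (intro divide_right_mono powr_mono2) auto
    then show ?thesis
      using assms by (smt (verit) mult_nonneg_nonneg powr_ge_zero)
  next
    case False
    then have "t powr (p - \<alpha>) \<le> a * p"
      using assms T aT powr_mono2'[of "p - \<alpha>" T t] by auto
    then have "t powr \<alpha> * t powr (p - \<alpha>) \<le> t powr \<alpha> * (a * p)"
      by (intro mult_left_mono) auto
    then have "t powr p / p \<le> a * t powr \<alpha>"
      using assms by (simp add: powr_add[symmetric] field_simps)
    then show ?thesis using assms by (smt (verit) divide_nonneg_pos powr_ge_zero)
  qed
  moreover have "T powr p / p \<ge> 0" using assms by simp
  ultimately show ?thesis using that by blast
qed

text \<open>For \<open>s > 0\<close> the kernel is positive, for \<open>s < 0\<close> it is minus a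
  power of order below \<alpha>, and for \<open>s = 0\<close> the logarithm is dominated by any
  positive power. The coefficient \<open>a\<close> is free so that a part of the field can absorb
  the kernel.\<close>

lemma riesz_kernel_lower_bound:
  assumes "0 < a" "max (- s) 0 < \<alpha>"
  obtains C where "C \<ge> 0"
    "\<And>x :: 'a::euclidean_space. - ereal (a * norm x powr \<alpha> + C) \<le> riesz_kernel s x"
proof -
  define p where "p = (if s < 0 then - s else \<alpha> / 2)"
  have p: "0 < p" "p < \<alpha>" using assms by (auto simp: p_def)
  obtain C where C: "C \<ge> 0" "\<And>t. t \<ge> 0 \<Longrightarrow> t powr p / p \<le> a * t powr \<alpha> + C"
    using powr_div_le_add_const[OF assms(1) p] by blast
  have "- ereal (a * norm x powr \<alpha> + C) \<le> riesz_kernel s x" for x :: 'a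
  proof -
    have nn: "a * norm x powr \<alpha> + C \<ge> 0" using assms C(1) by simp
    have bd: "norm x powr p / p \<le> a * norm x powr \<alpha> + C" using C by simp
    consider "x = 0" | "x \<noteq> 0" "s > 0" | "x \<noteq> 0" "s = 0" | "x \<noteq> 0" "s < 0" by linarith
    then show ?thesis
    proof cases
      case 1 then show ?thesis using C(1) by (cases "s < 0") (simp_all add: riesz_kernel_def)
    next
      case 2
      have "0 \<le> 1 / (s * norm x powr s)" using 2 by simp
      then have "- (a * norm x powr \<alpha> + C) \<le> 1 / (s * norm x powr s)"
        using nn by linarith
      then show ?thesis using 2 by (simp add: riesz_kernel_def)
    next
      case 3
      have "ln (norm x) \<le> norm x powr p / p"
      proof (cases "norm x \<ge> 1")
        case True then show ?thesis using ln_powr_bound[of "norm x" p] p by simp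
      next
        case False
        then have "ln (norm x) \<le> 0" by (simp add: 3 ln_le_zero_iff)
        then show ?thesis using p by (smt (verit) divide_nonneg_pos powr_ge_zero)
      qed
      then show ?thesis using 3 bd by (simp add: riesz_kernel_def)
    next
      case 4
      then have "1 / (s * norm x powr s) = - (norm x powr p / p)"
        by (simp add: p_def powr_minus field_simps)
      then show ?thesis using 4 bd by (simp add: riesz_kernel_def)
    qed
  qed
  then show ?thesis using C that by blast
qed

lemma riesz_kernel_measurable [measurable]:
  "riesz_kernel s \<in> borel_measurable (borel :: 'a::euclidean_space measure)"
  unfolding riesz_kernel_def by measurable

text \<open>Homogeneity of degree \<open>- s\<close> for nonzero \<open>s\<close>; at
  \<open>s = 0\<close> the factor is 1 and the logarithm yields a shift. One formula serves both
  cases.\<close>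

lemma riesz_kernel_scaleR:
  assumes "t > 0"
  shows "riesz_kernel s (t *\<^sub>R x) =
    ereal (t powr - s) * riesz_kernel s x + ereal (if s = 0 then - ln t else 0)"
  using assms by (auto simp: riesz_kernel_def ln_mult powr_mult powr_minus field_simps)

lemma riesz_kernel_sign:
  "s > 0 \<Longrightarrow> riesz_kernel s x > 0"
  "s < 0 \<Longrightarrow> riesz_kernel s x \<le> 0"
  "s < 0 \<Longrightarrow> riesz_kernel s x = 0 \<longleftrightarrow> x = 0"
  by (auto simp: riesz_kernel_def divide_le_0_iff mult_le_0_iff zero_ereal_def)

text \<open>The distance is at most twice the larger norm. Monotonicity takes the place of
  convexity, so exponents below 1 are covered.\<close>

lemma norm_diff_powr_le:
  fixes x y :: "'a::real_normed_vector"
  assumes "\<alpha> > 0"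
  shows "norm (x - y) powr \<alpha> \<le> 2 powr \<alpha> * (norm x powr \<alpha> + norm y powr \<alpha>)"
proof -
  have "norm (x - y) powr \<alpha> \<le> (2 * max (norm x) (norm y)) powr \<alpha>"
    using norm_triangle_ineq4[of x y] assms by (intro powr_mono2) auto
  also have "\<dots> = 2 powr \<alpha> * max (norm x) (norm y) powr \<alpha>"
    by (simp add: powr_mult)
  also have "\<dots> \<le> 2 powr \<alpha> * (norm x powr \<alpha> + norm y powr \<alpha>)"
    by (intro mult_left_mono) (auto simp: max_def)
  finally show ?thesis .
qed

lemma prob_measuresD:
  assumes "\<mu> \<in> prob_measures"
  shows "prob_space \<mu>" "sets \<mu> = sets borel"
  using assms by (auto simp: prob_measures_def)

lemma riesz_energy_eq_diff:
  "riesz_energy s \<mu> =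
    enn2ereal (\<integral>\<^sup>+ z. e2ennreal (riesz_kernel s (fst z - snd z)) \<partial>(\<mu> \<Otimes>\<^sub>M \<mu>)) -
    enn2ereal (\<integral>\<^sup>+ z. e2ennreal (- riesz_kernel s (fst z - snd z)) \<partial>(\<mu> \<Otimes>\<^sub>M \<mu>))"
  by (simp add: riesz_energy_def riesz_energy_field_def ereal_integral_def case_prod_beta
      zero_ereal_def[symmetric])

lemma riesz_kernel_not_MInf [simp]: "riesz_kernel s x \<noteq> - \<infinity>"
  by (auto simp: riesz_kernel_def)

lemma enn2ereal_diff_e2ennreal: "enn2ereal (e2ennreal x) - enn2ereal (e2ennreal (- x)) = x"
proof (cases "x \<ge> 0")
  case True then show ?thesis by (simp add: enn2ereal_e2ennreal e2ennreal_neg zero_ennreal.rep_eq)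
next
  case False then show ?thesis by (simp add: enn2ereal_e2ennreal e2ennreal_neg zero_ennreal.rep_eq)
qed

section \<open>The energy as a function of the moment\<close>

lemma nn_integral_pair_moments:
  fixes \<mu> :: "'a::euclidean_space measure"
  assumes \<mu>: "\<mu> \<in> prob_measures" and "k \<ge> 0"
  shows "(\<integral>\<^sup>+ z. ennreal (k * (norm (fst z) powr \<alpha> + norm (snd z) powr \<alpha>)) \<partial>(\<mu> \<Otimes>\<^sub>M \<mu>)) =
    ennreal (2 * k) * moment \<alpha> \<mu>"
proof -
  interpret prob_space \<mu> using prob_measuresD[OF \<mu>] by simp
  interpret pp: pair_prob_space \<mu> \<mu> ..
  note [measurable_cong] = prob_measuresD(2)[OF \<mu>]
  have meas: "(\<lambda>x. ennreal (norm x powr \<alpha>)) \<in> borel_measurable \<mu>" by measurable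
  have "(\<integral>\<^sup>+ z. ennreal (k * (norm (fst z) powr \<alpha> + norm (snd z) powr \<alpha>)) \<partial>(\<mu> \<Otimes>\<^sub>M \<mu>)) =
    (\<integral>\<^sup>+ z. ennreal k * ennreal (norm (fst z) powr \<alpha>) + ennreal k * ennreal (norm (snd z) powr \<alpha>) \<partial>(\<mu> \<Otimes>\<^sub>M \<mu>))"
    using assms by (intro nn_integral_cong) (simp add: ennreal_mult distrib_left)
  also have "\<dots> = ennreal k * moment \<alpha> \<mu> + ennreal k * moment \<alpha> \<mu>"
    using nn_integral_pair_prob[OF prob_space_axioms meas]
    by (simp add: nn_integral_add nn_integral_cmult)
  also have "ennreal k * moment \<alpha> \<mu> + ennreal k * moment \<alpha> \<mu> = ennreal (2 * k) * moment \<alpha> \<mu>"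
    using assms by (simp add: ennreal_mult mult_2[symmetric] mult.assoc)
  finally show ?thesis .
qed

text \<open>The negative part of the kernel grows at most like the power \<alpha> of the distance,
  hence is bounded by the two moments. So for a finite moment the energy is a genuine integral, and
  the convention for \<open>\<infinity> - \<infinity>\<close> does not interfere.\<close>

lemma nn_integral_neg_riesz_kernel_finite:
  fixes \<mu> :: "'a::euclidean_space measure"
  assumes \<mu>: "\<mu> \<in> prob_measures" and "max (- s) 0 < \<alpha>" and fin: "moment \<alpha> \<mu> < \<infinity>"
  shows "(\<integral>\<^sup>+ z. e2ennreal (- riesz_kernel s (fst z - snd z)) \<partial>(\<mu> \<Otimes>\<^sub>M \<mu>)) < \<infinity>"
proof -
  interpret prob_space \<mu> using prob_measuresD[OF \<mu>] by simp
  interpret pp: pair_prob_space \<mu> \<mu> ..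
  note [measurable_cong] = prob_measuresD(2)[OF \<mu>]
  obtain C where C: "C \<ge> 0"
    "\<And>x :: 'a. - ereal (1 * norm x powr \<alpha> + C) \<le> riesz_kernel s x"
    using riesz_kernel_lower_bound[of 1 s \<alpha>] assms(2) zero_less_one by blast
  have "(\<integral>\<^sup>+ z. e2ennreal (- riesz_kernel s (fst z - snd z)) \<partial>(\<mu> \<Otimes>\<^sub>M \<mu>)) \<le>
    (\<integral>\<^sup>+ z. ennreal (2 powr \<alpha> * (norm (fst z) powr \<alpha> + norm (snd z) powr \<alpha>)) + ennreal C \<partial>(\<mu> \<Otimes>\<^sub>M \<mu>))"
  proof (rule nn_integral_mono)
    fix z :: "'a \<times> 'a"
    have "- riesz_kernel s (fst z - snd z) \<le> ereal (norm (fst z - snd z) powr \<alpha> + C)"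
      using C(2)[of "fst z - snd z"] by (subst (asm) ereal_uminus_le_reorder) simp
    also have "\<dots> \<le> ereal (2 powr \<alpha> * (norm (fst z) powr \<alpha> + norm (snd z) powr \<alpha>) + C)"
      using norm_diff_powr_le[of \<alpha> "fst z" "snd z"] assms(2) by simp
    finally show "e2ennreal (- riesz_kernel s (fst z - snd z)) \<le>
      ennreal (2 powr \<alpha> * (norm (fst z) powr \<alpha> + norm (snd z) powr \<alpha>)) + ennreal C"
      using C(1) by (subst ennreal_plus[symmetric]) (auto simp: e2ennreal_mono simp flip: e2ennreal_ereal)
  qed
  also have "\<dots> < \<infinity>"
    using nn_integral_pair_moments[OF \<mu>, of "2 powr \<alpha>" \<alpha>] fin
    by (simp add: nn_integral_add ennreal_mult_less_top pp.emeasure_space_1)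
  finally show ?thesis .
qed

lemma riesz_energy_not_MInf:
  fixes \<mu> :: "'a::euclidean_space measure"
  assumes "\<mu> \<in> prob_measures" "max (- s) 0 < \<alpha>" "moment \<alpha> \<mu> < \<infinity>"
  shows "riesz_energy s \<mu> \<noteq> - \<infinity>"
  using nn_integral_neg_riesz_kernel_finite[OF assms] unfolding riesz_energy_eq_diff
  by (cases "\<integral>\<^sup>+ z. e2ennreal (riesz_kernel s (fst z - snd z)) \<partial>(\<mu> \<Otimes>\<^sub>M \<mu>)";
      cases "\<integral>\<^sup>+ z. e2ennreal (- riesz_kernel s (fst z - snd z)) \<partial>(\<mu> \<Otimes>\<^sub>M \<mu>)") auto

text \<open>Additivity of the integral; the factor 2 arises because both variables contribute the
  moment.\<close>

lemma riesz_energy_field_finite_moment: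
  fixes \<mu> :: "'a::euclidean_space measure"
  assumes \<mu>: "\<mu> \<in> prob_measures" and \<alpha>: "max (- s) 0 < \<alpha>" and \<gamma>: "\<gamma> > 0"
    and r: "moment \<alpha> \<mu> = ennreal r" "r \<ge> 0"
  shows "riesz_energy_field s (power_field \<gamma> \<alpha>) \<mu> = riesz_energy s \<mu> + ereal (2 * \<gamma> / \<alpha> * r)"
proof -
  interpret prob_space \<mu> using prob_measuresD[OF \<mu>] by simp
  note [measurable_cong] = prob_measuresD(2)[OF \<mu>]
  define P N where "P z = e2ennreal (riesz_kernel s (fst z - snd z))"
    and "N z = e2ennreal (- riesz_kernel s (fst z - snd z))" for z :: "'a \<times> 'a"
  define F where "F z = \<gamma> / \<alpha> * (norm (fst z) powr \<alpha> + norm (snd z) powr \<alpha>)" for z :: "'a \<times> 'a"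
  have \<gamma>\<alpha>: "\<gamma> / \<alpha> \<ge> 0" using \<alpha> \<gamma> by simp
  define m where "m = 2 * \<gamma> / \<alpha> * r"
  have m0: "m \<ge> 0" using \<alpha> \<gamma> r by (simp add: m_def)
  have F0: "F z \<ge> 0" for z unfolding F_def using \<gamma>\<alpha> by (intro mult_nonneg_nonneg) auto
  have [measurable]: "P \<in> borel_measurable (\<mu> \<Otimes>\<^sub>M \<mu>)" "N \<in> borel_measurable (\<mu> \<Otimes>\<^sub>M \<mu>)"
    "F \<in> borel_measurable (\<mu> \<Otimes>\<^sub>M \<mu>)"
    unfolding P_def N_def F_def by measurable
  have Nfin: "N z < \<infinity>" for z
    by (cases "riesz_kernel s (fst z - snd z)") (auto simp: N_def e2ennreal_neg)
  have NI: "(\<integral>\<^sup>+ z. N z \<partial>(\<mu> \<Otimes>\<^sub>M \<mu>)) < \<infinity>"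
    using nn_integral_neg_riesz_kernel_finite[OF \<mu> \<alpha>] r by (simp add: N_def)
  have FI: "(\<integral>\<^sup>+ z. ennreal (F z) \<partial>(\<mu> \<Otimes>\<^sub>M \<mu>)) = ennreal m"
    using nn_integral_pair_moments[OF \<mu> \<gamma>\<alpha>, of \<alpha>] r by (simp add: F_def m_def ennreal_mult''[symmetric])
  have "riesz_energy_field s (power_field \<gamma> \<alpha>) \<mu> =
      ereal_integral (\<mu> \<Otimes>\<^sub>M \<mu>) (\<lambda>z. riesz_kernel s (fst z - snd z) + ereal (F z))"
    by (simp add: riesz_energy_field_def case_prod_unfold power_field_def F_def distrib_left add.assoc)
  \<comment> \<open>The nonnegative field is added to the positive part \<open>P\<close> alone. The
    sum with \<open>F\<close> and \<open>N\<close> are in general not the positive and negative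
    parts of the integrand.\<close>
  also have "\<dots> = enn2ereal (\<integral>\<^sup>+ z. P z + ennreal (F z) \<partial>(\<mu> \<Otimes>\<^sub>M \<mu>)) - enn2ereal (\<integral>\<^sup>+ z. N z \<partial>(\<mu> \<Otimes>\<^sub>M \<mu>))"
  proof (rule ereal_integral_eq_diff)
    fix z
    have "riesz_kernel s (fst z - snd z) = enn2ereal (P z) - enn2ereal (N z)"
      by (simp add: P_def N_def enn2ereal_diff_e2ennreal)
    then show "riesz_kernel s (fst z - snd z) + ereal (F z) = enn2ereal (P z + ennreal (F z)) - enn2ereal (N z)"
      using Nfin[of z] F0[of z] by (cases "P z"; cases "N z") (auto simp: plus_ennreal.rep_eq)
  qed (use Nfin NI in auto)
  also have "\<dots> = riesz_energy s \<mu> + ereal m"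
    using NI m0 unfolding riesz_energy_eq_diff P_def[symmetric] N_def[symmetric]
    by (subst nn_integral_add; (cases "\<integral>\<^sup>+ z. P z \<partial>(\<mu> \<Otimes>\<^sub>M \<mu>)"; cases "\<integral>\<^sup>+ z. N z \<partial>(\<mu> \<Otimes>\<^sub>M \<mu>)")?)
      (auto simp: plus_ennreal.rep_eq FI)
  finally show ?thesis by (simp only: m_def)
qed

lemma riesz_energy_field_infinite_moment:
  fixes \<mu> :: "'a::euclidean_space measure"
  assumes \<mu>: "\<mu> \<in> prob_measures" and \<alpha>: "max (- s) 0 < \<alpha>" and \<gamma>: "\<gamma> > 0"
    and inf: "moment \<alpha> \<mu> = \<infinity>"
  shows "riesz_energy_field s (power_field \<gamma> \<alpha>) \<mu> = \<infinity>"
proof -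
  interpret prob_space \<mu> using prob_measuresD[OF \<mu>] by simp
  interpret pp: pair_prob_space \<mu> \<mu> ..
  note [measurable_cong] = prob_measuresD(2)[OF \<mu>]
  \<comment> \<open>\<open>k\<close> is half the coefficient of the field: one half absorbs the
    lower bound of the kernel, and the other half, \<open>F\<close>, still has infinite
    integral.\<close>
  define k where "k = \<gamma> / (2 * \<alpha>)"
  have k: "k > 0" using \<alpha> \<gamma> by (simp add: k_def)
  have "k / 2 powr \<alpha> > 0" using k by simp
  then obtain C where C: "C \<ge> 0"
    "\<And>x :: 'a. - ereal (k / 2 powr \<alpha> * norm x powr \<alpha> + C) \<le> riesz_kernel s x"
    using riesz_kernel_lower_bound \<alpha> by blast
  define f where "f z = riesz_kernel s (fst z - snd z) + ereal (power_field \<gamma> \<alpha> (fst z)) +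
    ereal (power_field \<gamma> \<alpha> (snd z))" for z :: "'a \<times> 'a"
  define F where "F z = k * (norm (fst z) powr \<alpha> + norm (snd z) powr \<alpha>)" for z :: "'a \<times> 'a"
  have [measurable]: "f \<in> borel_measurable (\<mu> \<Otimes>\<^sub>M \<mu>)" "F \<in> borel_measurable (\<mu> \<Otimes>\<^sub>M \<mu>)"
    unfolding f_def F_def power_field_def by measurable
  have F0: "F z \<ge> 0" for z using k by (simp add: F_def)
  have bd: "ereal (F z - C) \<le> f z" for z
  proof -
    have "k / 2 powr \<alpha> * norm (fst z - snd z) powr \<alpha> \<le>
        k / 2 powr \<alpha> * (2 powr \<alpha> * (norm (fst z) powr \<alpha> + norm (snd z) powr \<alpha>))"
      using norm_diff_powr_le[of \<alpha> "fst z" "snd z"] k \<alpha> by (intro mult_left_mono) auto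
    also have "\<dots> = F z" by (simp add: F_def)
    finally have "k / 2 powr \<alpha> * norm (fst z - snd z) powr \<alpha> \<le> F z" .
    then have "- ereal (F z + C) \<le> riesz_kernel s (fst z - snd z)"
      using C(2)[of "fst z - snd z"] by (auto intro: order.trans[rotated])
    then have "- ereal (F z + C) + (ereal (power_field \<gamma> \<alpha> (fst z)) + ereal (power_field \<gamma> \<alpha> (snd z))) \<le> f z"
      unfolding f_def add.assoc by (rule add_right_mono)
    moreover have "- (F z + C) + (power_field \<gamma> \<alpha> (fst z) + power_field \<gamma> \<alpha> (snd z)) = F z - C"
      by (simp add: F_def power_field_def k_def field_simps add_divide_distrib)
    ultimately show ?thesis by simp
  qed
  have "\<infinity> = (\<integral>\<^sup>+ z. ennreal (F z) \<partial>(\<mu> \<Otimes>\<^sub>M \<mu>))"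
    using nn_integral_pair_moments[OF \<mu> less_imp_le[OF k], of \<alpha>] inf k
    by (simp add: F_def ennreal_mult_top)
  also have "\<dots> \<le> (\<integral>\<^sup>+ z. e2ennreal (f z) + ennreal C \<partial>(\<mu> \<Otimes>\<^sub>M \<mu>))"
  proof (rule nn_integral_mono)
    fix z
    have "ennreal (F z) \<le> ennreal (F z - C) + ennreal C"
      using C(1) F0[of z] by (cases "C \<le> F z") (auto simp: ennreal_plus[symmetric] ennreal_neg ennreal_leI simp del: ennreal_plus)
    also have "ennreal (F z - C) \<le> e2ennreal (f z)"
      using e2ennreal_mono[OF bd[of z]] by simp
    finally show "ennreal (F z) \<le> e2ennreal (f z) + ennreal C" by (simp add: add_right_mono)
  qed
  also have "\<dots> = (\<integral>\<^sup>+ z. e2ennreal (f z) \<partial>(\<mu> \<Otimes>\<^sub>M \<mu>)) + ennreal C"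
    by (simp add: nn_integral_add pp.emeasure_space_1)
  finally have "(\<integral>\<^sup>+ z. e2ennreal (f z) \<partial>(\<mu> \<Otimes>\<^sub>M \<mu>)) = \<infinity>" by (simp add: top_unique)
  \<comment> \<open>With an infinite positive part the value is \<open>\<infinity>\<close>, whatever
    the negative part is.\<close>
  then show ?thesis
    by (simp add: riesz_energy_field_def ereal_integral_def case_prod_beta f_def[symmetric])
qed

text \<open>A vanishing moment puts all mass at the origin, so the energy is the value of the kernel
  at 0.\<close>

lemma riesz_energy_zero_moment:
  fixes \<mu> :: "'a::euclidean_space measure"
  assumes \<mu>: "\<mu> \<in> prob_measures" and "moment \<alpha> \<mu> = 0"
  shows "riesz_energy s \<mu> = (if s < 0 then 0 else \<infinity>)"
proof -
  interpret prob_space \<mu> using prob_measuresD[OF \<mu>] by simp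
  interpret pp: pair_prob_space \<mu> \<mu> ..
  note [measurable_cong] = prob_measuresD(2)[OF \<mu>]
  have "(\<integral>\<^sup>+ z. ennreal (1 * (norm (fst z) powr \<alpha> + norm (snd z) powr \<alpha>)) \<partial>(\<mu> \<Otimes>\<^sub>M \<mu>)) = 0"
    using nn_integral_pair_moments[OF \<mu>, of 1 \<alpha>] assms(2) by simp
  then have "AE z in \<mu> \<Otimes>\<^sub>M \<mu>. ennreal (1 * (norm (fst z) powr \<alpha> + norm (snd z) powr \<alpha>)) = 0"
    by (subst (asm) nn_integral_0_iff_AE) auto
  then have "AE z in \<mu> \<Otimes>\<^sub>M \<mu>. fst z - snd z = 0"
  proof eventually_elim
    case (elim z)
    then have "norm (fst z) powr \<alpha> + norm (snd z) powr \<alpha> = 0"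
      by (simp add: antisym del: ennreal_plus)
    then show ?case by (simp add: add_nonneg_eq_0_iff)
  qed
  then have "(\<integral>\<^sup>+ z. e2ennreal (riesz_kernel s (fst z - snd z)) \<partial>(\<mu> \<Otimes>\<^sub>M \<mu>)) =
      (\<integral>\<^sup>+ z. e2ennreal (riesz_kernel s (0::'a)) \<partial>(\<mu> \<Otimes>\<^sub>M \<mu>))"
    "(\<integral>\<^sup>+ z. e2ennreal (- riesz_kernel s (fst z - snd z)) \<partial>(\<mu> \<Otimes>\<^sub>M \<mu>)) =
      (\<integral>\<^sup>+ z. e2ennreal (- riesz_kernel s (0::'a)) \<partial>(\<mu> \<Otimes>\<^sub>M \<mu>))"
    by (auto intro!: nn_integral_cong_AE elim!: eventually_mono simp del: nn_integral_const)
  then show ?thesis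
    unfolding riesz_energy_eq_diff
    by (simp add: pp.emeasure_space_1 riesz_kernel_def e2ennreal_neg)
qed

section \<open>Dilations\<close>

lemma dilate_in_prob_measures: "\<mu> \<in> prob_measures \<Longrightarrow> dilate c \<mu> \<in> prob_measures"
  by (auto simp: prob_measures_def dilate_def intro!: prob_space.prob_space_distr
      cong: measurable_cong_sets)

lemma dilate_dilate:
  assumes "\<mu> \<in> prob_measures"
  shows "dilate a (dilate b \<mu>) = dilate (a * b) \<mu>"
proof -
  note [measurable_cong] = prob_measuresD(2)[OF assms]
  show ?thesis unfolding dilate_def by (subst distr_distr) (auto simp: comp_def)
qed

lemma dilate_1: "\<mu> \<in> prob_measures \<Longrightarrow> dilate 1 \<mu> = \<mu>"
  by (simp add: dilate_def distr_id2[OF prob_measuresD(2)[symmetric]])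

lemma moment_dilate:
  assumes "\<mu> \<in> prob_measures" "t \<ge> 0"
  shows "moment \<alpha> (dilate t \<mu>) = ennreal (t powr \<alpha>) * moment \<alpha> \<mu>"
proof -
  note [measurable_cong] = prob_measuresD(2)[OF assms(1)]
  show ?thesis
    using assms(2) unfolding dilate_def
    by (subst nn_integral_distr) (auto simp: powr_mult ennreal_mult nn_integral_cmult)
qed

text \<open>The product of the dilated measures is the image of the product measure, so the scaling
  law of the kernel can be integrated. Finiteness of the moment allows the integral to be
  split.\<close>

lemma riesz_energy_dilate:
  fixes \<mu> :: "'a::euclidean_space measure"
  assumes \<mu>: "\<mu> \<in> prob_measures" and \<alpha>: "max (- s) 0 < \<alpha>" and "moment \<alpha> \<mu> < \<infinity>" and t: "t > 0"
  shows "riesz_energy s (dilate t \<mu>) =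
    ereal (t powr - s) * riesz_energy s \<mu> + ereal (if s = 0 then - ln t else 0)"
proof -
  interpret prob_space \<mu> using prob_measuresD[OF \<mu>] by simp
  interpret pp: pair_prob_space \<mu> \<mu> ..
  note [measurable_cong] = prob_measuresD(2)[OF \<mu>]
  define P N where "P z = e2ennreal (riesz_kernel s (fst z - snd z))"
    and "N z = e2ennreal (- riesz_kernel s (fst z - snd z))" for z :: "'a \<times> 'a"
  define a b where "a = t powr - s" and "b = (if s = 0 then - ln t else 0)"
  have a: "a > 0" using t by (simp add: a_def)
  have [measurable]: "P \<in> borel_measurable (\<mu> \<Otimes>\<^sub>M \<mu>)" "N \<in> borel_measurable (\<mu> \<Otimes>\<^sub>M \<mu>)"
    unfolding P_def N_def by measurable
  have Nfin: "N z < \<infinity>" for z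
    by (cases "riesz_kernel s (fst z - snd z)") (auto simp: N_def e2ennreal_neg)
  have NI: "(\<integral>\<^sup>+ z. N z \<partial>(\<mu> \<Otimes>\<^sub>M \<mu>)) < \<infinity>"
    using nn_integral_neg_riesz_kernel_finite[OF assms(1-3)] by (simp add: N_def)
  have "prob_space (dilate t \<mu>)"
    using dilate_in_prob_measures[OF \<mu>] by (rule prob_measuresD)
  then interpret D: prob_space "dilate t \<mu>" .
  have pair: "dilate t \<mu> \<Otimes>\<^sub>M dilate t \<mu> =
      distr (\<mu> \<Otimes>\<^sub>M \<mu>) (borel \<Otimes>\<^sub>M borel) (\<lambda>(x, y). (t *\<^sub>R x, t *\<^sub>R y))"
    unfolding dilate_def
    by (rule pair_measure_distr) (use D.sigma_finite_measure_axioms in \<open>auto simp: dilate_def\<close>)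
  have "riesz_energy s (dilate t \<mu>) =
      ereal_integral (\<mu> \<Otimes>\<^sub>M \<mu>) (\<lambda>z. riesz_kernel s (t *\<^sub>R (fst z - snd z)))"
    unfolding riesz_energy_eq_diff ereal_integral_def pair
    by (subst (1 2) nn_integral_distr) (auto simp: case_prod_unfold scaleR_diff_right)
  also have "\<dots> = ereal_integral (\<mu> \<Otimes>\<^sub>M \<mu>) (\<lambda>z. ereal a * riesz_kernel s (fst z - snd z) + ereal b)"
    using t by (simp add: riesz_kernel_scaleR a_def b_def)
  \<comment> \<open>The shift \<open>b\<close> may have either sign. As \<open>ennreal\<close> maps
    negative numbers to 0, \<open>ennreal b\<close> and \<open>ennreal (- b)\<close> are its
    positive and negative parts.\<close>
  also have "\<dots> = enn2ereal (\<integral>\<^sup>+ z. ennreal a * P z + ennreal b \<partial>(\<mu> \<Otimes>\<^sub>M \<mu>)) -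
      enn2ereal (\<integral>\<^sup>+ z. ennreal a * N z + ennreal (- b) \<partial>(\<mu> \<Otimes>\<^sub>M \<mu>))"
  proof (rule ereal_integral_eq_diff)
    fix z
    have "riesz_kernel s (fst z - snd z) = enn2ereal (P z) - enn2ereal (N z)"
      by (simp add: P_def N_def enn2ereal_diff_e2ennreal)
    then show "ereal a * riesz_kernel s (fst z - snd z) + ereal b =
        enn2ereal (ennreal a * P z + ennreal b) - enn2ereal (ennreal a * N z + ennreal (- b))"
      using Nfin[of z] a by (cases "P z"; cases "N z"; cases "b \<ge> 0")
        (auto simp: plus_ennreal.rep_eq times_ennreal.rep_eq ennreal_neg zero_ennreal.rep_eq algebra_simps)
    show "ennreal a * N z + ennreal (- b) < \<infinity>"
      using Nfin[of z] by (auto simp: ennreal_mult_less_top)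
    show "(\<integral>\<^sup>+ z. ennreal a * N z + ennreal (- b) \<partial>(\<mu> \<Otimes>\<^sub>M \<mu>)) < \<infinity>"
      using NI by (simp add: nn_integral_add nn_integral_cmult ennreal_mult_less_top pp.emeasure_space_1)
  qed auto
  also have "\<dots> = ereal a * riesz_energy s \<mu> + ereal b"
    unfolding riesz_energy_eq_diff P_def[symmetric] N_def[symmetric]
    using NI a
    by (subst (1 2) nn_integral_add; (cases "\<integral>\<^sup>+ z. P z \<partial>(\<mu> \<Otimes>\<^sub>M \<mu>)"; cases "\<integral>\<^sup>+ z. N z \<partial>(\<mu> \<Otimes>\<^sub>M \<mu>)"; cases "b \<ge> 0")?)
      (auto simp: plus_ennreal.rep_eq times_ennreal.rep_eq ennreal_neg zero_ennreal.rep_eq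
        nn_integral_cmult pp.emeasure_space_1 algebra_simps)
  finally show ?thesis by (simp add: a_def b_def)
qed

section \<open>Sign and finiteness of the energy\<close>

lemma riesz_energy_nonpos:
  assumes "s < 0" shows "riesz_energy s \<mu> \<le> 0"
proof -
  have "e2ennreal (riesz_kernel s x) = 0" for x :: 'a
    using riesz_kernel_sign(2)[OF assms, of x] by (intro e2ennreal_neg)
  then show ?thesis by (simp add: riesz_energy_eq_diff zero_ennreal.rep_eq)
qed

lemma riesz_energy_pos:
  fixes \<mu> :: "'a::euclidean_space measure"
  assumes "s > 0" and \<mu>: "\<mu> \<in> prob_measures"
  shows "riesz_energy s \<mu> > 0"
proof -
  interpret prob_space \<mu> using prob_measuresD[OF \<mu>] by simp
  interpret pp: pair_prob_space \<mu> \<mu> ..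
  note [measurable_cong] = prob_measuresD(2)[OF \<mu>]
  have pos: "e2ennreal (riesz_kernel s x) \<noteq> 0" for x :: 'a
    using riesz_kernel_sign(1)[OF assms(1), of x]
    by (cases "riesz_kernel s x") (auto simp: ennreal_eq_0_iff)
  have "e2ennreal (- riesz_kernel s x) = 0" for x :: 'a
    using riesz_kernel_sign(1)[OF assms(1), of x] by (intro e2ennreal_neg) (simp add: less_imp_le)
  moreover have "(\<integral>\<^sup>+ z. e2ennreal (riesz_kernel s (fst z - snd z)) \<partial>(\<mu> \<Otimes>\<^sub>M \<mu>)) \<noteq> 0"
    using pos by (subst nn_integral_0_iff_AE) auto
  ultimately show ?thesis
    unfolding riesz_energy_eq_diff
    by (cases "\<integral>\<^sup>+ z. e2ennreal (riesz_kernel s (fst z - snd z)) \<partial>(\<mu> \<Otimes>\<^sub>M \<mu>)")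
      (auto simp: zero_ennreal.rep_eq)
qed

text \<open>The nonnegative function \<open>- riesz_kernel s\<close> then has integral 0 and
  vanishes almost everywhere; its zeros are the pairs on the diagonal. This makes the energy of an
  atomless measure strictly negative.\<close>

lemma riesz_energy_eq_0_imp_AE:
  fixes \<mu> :: "'a::euclidean_space measure"
  assumes "s < 0" and \<mu>: "\<mu> \<in> prob_measures" and "riesz_energy s \<mu> = 0"
  shows "AE x in \<mu>. AE y in \<mu>. x = y"
proof -
  interpret prob_space \<mu> using prob_measuresD[OF \<mu>] by simp
  interpret pp: pair_prob_space \<mu> \<mu> ..
  note [measurable_cong] = prob_measuresD(2)[OF \<mu>]
  have 1: "e2ennreal (riesz_kernel s x) = 0" for x :: 'a
    using riesz_kernel_sign(2)[OF assms(1), of x] by (intro e2ennreal_neg)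
  have "e2ennreal (- riesz_kernel s x) = 0 \<Longrightarrow> x = 0" for x :: 'a
    using riesz_kernel_sign(2,3)[OF assms(1), of x]
    by (cases "riesz_kernel s x") (auto simp: ennreal_eq_0_iff zero_ereal_def)
  then have 2: "e2ennreal (- riesz_kernel s (x - y)) = 0 \<Longrightarrow> x = y" for x y :: 'a
    by force
  have "(\<integral>\<^sup>+ z. e2ennreal (- riesz_kernel s (fst z - snd z)) \<partial>(\<mu> \<Otimes>\<^sub>M \<mu>)) = 0"
    using assms(3) unfolding riesz_energy_eq_diff 1
    by (cases "\<integral>\<^sup>+ z. e2ennreal (- riesz_kernel s (fst z - snd z)) \<partial>(\<mu> \<Otimes>\<^sub>M \<mu>)")
      (auto simp: zero_ennreal.rep_eq)
  then have "AE z in \<mu> \<Otimes>\<^sub>M \<mu>. e2ennreal (- riesz_kernel s (fst z - snd z)) = 0"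
    by (subst (asm) nn_integral_0_iff_AE) auto
  then have "AE z in \<mu> \<Otimes>\<^sub>M \<mu>. fst z = snd z"
    by eventually_elim (use 2 in auto)
  from pp.AE_pair[OF this] show ?thesis by simp
qed

section \<open>A measure of unit moment with finite energy\<close>

lemma borel_ball [measurable]: "ball c r \<in> sets borel"
  by simp

text \<open>Compare \<open>\<parallel>z\<parallel>\<^sup>-\<^sup>s\<close> with a step function that is constant on dyadic shells.\<close>
lemma nn_integral_ball_norm_powr_finite:
  fixes s :: real
  assumes s: "0 < s" "s < DIM('a)"
  shows "(\<integral>\<^sup>+ z. ennreal (norm z powr - s) * indicator (ball 0 2) z \<partial>(lborel :: 'a::euclidean_space measure)) < \<infinity>"
proof -
  \<comment> \<open>The weight is the value of the power at norm \<open>2 powr - k\<close>, the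
    inner radius of the shell; the ball has the outer radius, twice as large.\<close>
  define g where "g k z = ennreal (2 powr (s * real k)) * indicator (ball 0 (2 * 2 powr - real k)) z"
    for k :: nat and z :: 'a
  have [measurable]: "g k \<in> borel_measurable borel" for k
    unfolding g_def by measurable
  \<comment> \<open>The weight of \<open>g k\<close> grows by \<open>2 powr s\<close> per step while
    the volume shrinks by 2 to the power of the dimension, so the integrals form a geometric series
    of ratio \<open>q\<close>.\<close>
  define q where "q = 2 powr (s - real DIM('a))"
  define B where "B = unit_ball_vol (real DIM('a)) * 2 ^ DIM('a)"
  have q: "0 < q" "q < 1" using s by (auto simp: q_def powr_less_one)
  have B: "B \<ge> 0" by (simp add: B_def)
  have le: "ennreal (norm z powr - s) * indicator (ball 0 2) z \<le> (\<Sum>k. g k z)" for z :: 'a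
  proof (cases "z = 0 \<or> norm z \<ge> 2")
    \<comment> \<open>The origin contributes 0 because \<open>0 powr - s = 0\<close>; outside the
      ball the indicator vanishes.\<close>
    case True then show ?thesis using s by auto
  next
    case False
    then have z: "norm z > 0" "norm z < 2" by auto
    obtain n where "(1 / 2) ^ n < norm z"
      using real_arch_pow_inv[of "norm z" "1/2"] z by auto
    then have "2 powr - real n \<le> norm z"
      by (simp add: powr_minus powr_realpow power_one_over inverse_eq_divide)
    \<comment> \<open>Minimality of \<open>k\<close> gives the upper bound for the norm in terms of
      the preceding shell; at \<open>k = 0\<close> that bound is the radius 2 of the ball.\<close>
    then obtain k where k: "2 powr - real k \<le> norm z"
      and min: "\<And>j. j < k \<Longrightarrow> \<not> 2 powr - real j \<le> norm z"
      using exists_least_iff[of "\<lambda>k. 2 powr - real k \<le> norm z"] by blast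
    have "norm z < 2 * 2 powr - real k"
    proof (cases k)
      case 0 then show ?thesis using z by simp
    next
      case (Suc j)
      then show ?thesis using min[of j] by (simp add: powr_diff powr_minus field_simps powr_add)
    qed
    then have ind: "indicator (ball 0 (2 * 2 powr - real k)) z = (1::ennreal)" by simp
    have "norm z powr - s \<le> (2 powr - real k) powr - s"
      using s k by (intro powr_mono2') auto
    also have "\<dots> = 2 powr (s * real k)" by (simp add: powr_powr mult.commute)
    finally have "ennreal (norm z powr - s) * indicator (ball 0 2) z \<le> g k z"
      using ind by (simp add: g_def ennreal_leI indicator_def)
    also have "\<dots> \<le> (\<Sum>k. g k z)"
      using sum_le_suminf[of "\<lambda>k. g k z" "{k}"] by auto
    finally show ?thesis .
  qed
  have int: "(\<integral>\<^sup>+ z. g k z \<partial>lborel) = ennreal (B * q ^ k)" for k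
  proof -
    have "(\<integral>\<^sup>+ z. g k z \<partial>lborel) = ennreal (2 powr (s * real k)) *
        ennreal (unit_ball_vol (real DIM('a)) * (2 * 2 powr - real k) ^ DIM('a))"
      unfolding g_def by (subst nn_integral_cmult_indicator) (auto simp: emeasure_ball)
    also have "\<dots> = ennreal (2 powr (s * real k) *
        (unit_ball_vol (real DIM('a)) * (2 * 2 powr - real k) ^ DIM('a)))"
      by (simp add: ennreal_mult)
    also have "2 powr (s * real k) * (unit_ball_vol (real DIM('a)) * (2 * 2 powr - real k) ^ DIM('a)) = B * q ^ k"
    proof -
      have "(2 powr - real k) ^ DIM('a) = 2 powr (- real k * DIM('a))"
        by (simp add: powr_realpow[symmetric] powr_powr)
      moreover have "q ^ k = 2 powr (s * real k) * 2 powr (- real k * DIM('a))"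
        by (simp add: q_def powr_realpow[symmetric] powr_powr powr_add[symmetric] algebra_simps)
      ultimately show ?thesis by (simp add: B_def power_mult_distrib)
    qed
    finally show ?thesis .
  qed
  have "(\<integral>\<^sup>+ z. ennreal (norm z powr - s) * indicator (ball 0 2) z \<partial>(lborel :: 'a measure)) \<le> (\<integral>\<^sup>+ z. (\<Sum>k. g k z) \<partial>lborel)"
    using le by (intro nn_integral_mono)
  also have "\<dots> = (\<Sum>k. ennreal (B * q ^ k))"
    by (subst nn_integral_suminf) (simp_all add: int)
  also have "\<dots> < \<infinity>"
    using q B by (simp add: less_top[symmetric] ennreal_suminf_neq_top summable_mult summable_geometric)
  finally show ?thesis .
qed

text \<open>Away from 0 the positive part is at most \<open>norm z powr - p / p\<close> with
  \<open>p\<close> strictly between 0 and the dimension: \<open>p = s\<close> for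
  \<open>s > 0\<close>, otherwise half the dimension, the logarithm being bounded by a power of
  \<open>inverse (norm z)\<close>.\<close>

lemma nn_integral_ball_pos_riesz_kernel_finite:
  fixes s :: real
  assumes s: "s < DIM('a)"
  shows "(\<integral>\<^sup>+ z. e2ennreal (riesz_kernel s z) * indicator (ball 0 2) z \<partial>(lborel :: 'a::euclidean_space measure)) < \<infinity>"
proof -
  define p where "p = (if s > 0 then s else DIM('a) / 2)"
  have p: "0 < p" "p < DIM('a)" using s by (auto simp: p_def)
  have le: "e2ennreal (riesz_kernel s z) \<le> ennreal (1 / p) * ennreal (norm z powr - p)" if "z \<noteq> 0" for z :: 'a
  proof -
    consider "s < 0" | "s = 0" | "s > 0" by linarith
    then have "riesz_kernel s z \<le> ereal (norm z powr - p / p)"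
    proof cases
      case 1
      then show ?thesis
        using riesz_kernel_sign(2)[OF 1, of z] p by (auto intro: order.trans)
    next
      case 2
      have "ln (inverse (norm z)) \<le> inverse (norm z) powr p / p"
      proof (cases "norm z \<le> 1")
        case True then show ?thesis using ln_powr_bound[of "inverse (norm z)" p] p that
          by (simp add: one_le_inverse)
      next
        case False
        then have "ln (inverse (norm z)) \<le> 0" by (simp add: ln_inverse)
        then show ?thesis using p by (smt (verit) divide_nonneg_pos powr_ge_zero)
      qed
      then show ?thesis using 2 that by (simp add: riesz_kernel_def ln_inverse powr_minus inverse_powr)
    next
      case 3
      then show ?thesis using that by (simp add: riesz_kernel_def p_def powr_minus field_simps)
    qed
    then show ?thesis
      using e2ennreal_mono p by (fastforce simp: ennreal_mult''[symmetric])
  qed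
  have "(\<integral>\<^sup>+ z. e2ennreal (riesz_kernel s z) * indicator (ball 0 2) z \<partial>(lborel :: 'a measure)) \<le>
    (\<integral>\<^sup>+ z. ennreal (1 / p) * (ennreal (norm z powr - p) * indicator (ball 0 2) z) \<partial>(lborel :: 'a measure))"
    \<comment> \<open>At the origin the bound fails for nonnegative \<open>s\<close>, since the
      kernel is infinite there and \<open>0 powr - p = 0\<close>; a single point is a null
      set.\<close>
    by (rule nn_integral_mono_AE, use AE_lborel_singleton[of 0] in eventually_elim)
      (use le in \<open>auto simp: indicator_def\<close>)
  also have "\<dots> < \<infinity>"
    using nn_integral_ball_norm_powr_finite[OF p]
    by (subst nn_integral_cmult) (auto simp: ennreal_mult_less_top)
  finally show ?thesis .
qed

lemma inverse_root_powr_mult: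
  fixes r \<alpha> :: real
  assumes "r > 0" "\<alpha> \<noteq> 0"
  shows "inverse (r powr (1 / \<alpha>)) powr \<alpha> * r = 1"
proof -
  have "inverse (r powr (1 / \<alpha>)) powr \<alpha> = (r powr (- (1 / \<alpha>))) powr \<alpha>"
    by (simp add: powr_minus)
  also have "\<dots> = 1 / r"
    unfolding powr_powr using assms by (simp add: powr_neg_one)
  finally show ?thesis using assms by simp
qed

text \<open>The uniform distribution on the unit ball has finite energy by local integrability of
  the kernel; a dilation then normalizes its moment without changing finiteness or, for
  \<open>s < 0\<close>, the sign.\<close>

lemma exists_finite_riesz_energy:
  fixes T :: "'a::euclidean_space itself" and s :: real
  assumes s: "s < DIM('a)" and \<alpha>: "max (- s) 0 < \<alpha>"
  obtains \<nu> :: "'a measure" where "\<nu> \<in> prob_measures_moment \<alpha> 1" "riesz_energy s \<nu> < \<infinity>"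
    "s < 0 \<Longrightarrow> riesz_energy s \<nu> < 0"
proof -
  define A where "A = ball (0::'a) 1"
  define U where "U = uniform_measure lborel A"
  have A [measurable]: "A \<in> sets borel" by (simp add: A_def)
  have eA: "emeasure lborel A = ennreal (unit_ball_vol (real DIM('a)))"
    by (simp add: A_def emeasure_ball)
  have eA0: "emeasure lborel A \<noteq> 0" "emeasure lborel A \<noteq> \<infinity>"
    by (simp_all add: eA ennreal_eq_0_iff not_le)
  then have U: "U \<in> prob_measures"
    by (auto simp: prob_measures_def U_def intro: prob_space_uniform_measure)
  interpret prob_space U using prob_measuresD[OF U] by simp
  note [measurable_cong] = prob_measuresD(2)[OF U]
  have AE_ne: "AE x in U. x \<noteq> c" for c
    using AE_lborel_singleton[of c] unfolding U_def by (intro AE_uniform_measureI) auto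
  have AE_A: "AE x in U. x \<in> A"
    unfolding U_def by (intro AE_uniform_measureI) auto
  have "moment \<alpha> U \<le> (\<integral>\<^sup>+ x. 1 \<partial>U)"
    by (rule nn_integral_mono_AE, use AE_A in eventually_elim)
      (use \<alpha> in \<open>auto simp: A_def powr_le1\<close>)
  then have "moment \<alpha> U < \<infinity>"
    by (auto simp: emeasure_space_1 intro: le_less_trans)
  moreover have "moment \<alpha> U \<noteq> 0"
  proof
    assume "moment \<alpha> U = 0"
    then have "AE x in U. ennreal (norm x powr \<alpha>) = 0" by (subst (asm) nn_integral_0_iff_AE) auto
    then have "AE x in U. False" using AE_ne[of 0] by eventually_elim (auto simp: ennreal_eq_0_iff)
    then show False by simp
  qed
  ultimately obtain r where r: "moment \<alpha> U = ennreal r" "r > 0"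
    by (cases "moment \<alpha> U") (auto simp: less_le)
  define B where "B = (\<integral>\<^sup>+ z. e2ennreal (riesz_kernel s z) * indicator (ball 0 2) z \<partial>(lborel :: 'a measure))"
  have B: "B < \<infinity>" using nn_integral_ball_pos_riesz_kernel_finite[OF s] by (simp add: B_def)
  \<comment> \<open>Differences of points of the unit ball lie in the ball of radius 2. Reflection
    and translation preserve Lebesgue measure, so the bound is uniform in \<open>x\<close>.\<close>
  have inner: "(\<integral>\<^sup>+ y. e2ennreal (riesz_kernel s (x - y)) \<partial>U) \<le> B / emeasure lborel A" if "x \<in> A" for x
  proof -
    have refl: "(lborel :: 'a measure) = distr lborel borel (\<lambda>y. x - y)"
      using lborel_affine[of "-1" x] by (simp add: density_1)
    have "(\<integral>\<^sup>+ y. e2ennreal (riesz_kernel s (x - y)) * indicator A y \<partial>lborel) \<le>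
        (\<integral>\<^sup>+ y. e2ennreal (riesz_kernel s (x - y)) * indicator (ball 0 2) (x - y) \<partial>lborel)"
    proof (intro nn_integral_mono mult_left_mono)
      fix y
      have "norm (x - y) < 2" if "y \<in> A"
        using that \<open>x \<in> A\<close> norm_triangle_ineq4[of x y] by (simp add: A_def)
      then show "(indicator A y :: ennreal) \<le> indicator (ball 0 2) (x - y)"
        by (auto simp: indicator_def)
    qed auto
    also have "\<dots> = B"
    proof -
      have "B = (\<integral>\<^sup>+ z. e2ennreal (riesz_kernel s z) * indicator (ball 0 2) z
          \<partial>distr lborel borel (\<lambda>y. x - y))"
        by (simp only: B_def refl[symmetric])
      then show ?thesis
        by (subst (asm) nn_integral_distr) auto
    qed
    finally show ?thesis
      unfolding U_def by (subst nn_integral_uniform_measure) (auto simp: A divide_right_mono_ennreal)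
  qed
  have "(\<integral>\<^sup>+ z. e2ennreal (riesz_kernel s (fst z - snd z)) \<partial>(U \<Otimes>\<^sub>M U)) =
      (\<integral>\<^sup>+ x. \<integral>\<^sup>+ y. e2ennreal (riesz_kernel s (x - y)) \<partial>U \<partial>U)"
    by (subst nn_integral_fst[symmetric]) auto
  also have "\<dots> \<le> (\<integral>\<^sup>+ x. B / emeasure lborel A \<partial>U)"
    by (rule nn_integral_mono_AE, use AE_A in eventually_elim) (rule inner)
  also have "\<dots> < \<infinity>"
    using B eA0 by (simp add: emeasure_space_1 ennreal_divide_eq_top_iff less_top[symmetric])
  finally have efin: "riesz_energy s U < \<infinity>"
    unfolding riesz_energy_eq_diff
    by (cases "\<integral>\<^sup>+ z. e2ennreal (riesz_kernel s (fst z - snd z)) \<partial>(U \<Otimes>\<^sub>M U)";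
        cases "\<integral>\<^sup>+ z. e2ennreal (- riesz_kernel s (fst z - snd z)) \<partial>(U \<Otimes>\<^sub>M U)") auto
  have eneg: "riesz_energy s U < 0" if "s < 0"
  proof -
    \<comment> \<open>\<open>U\<close> has no atoms, so almost every pair is off the
      diagonal.\<close>
    have "riesz_energy s U \<noteq> 0"
    proof
      assume "riesz_energy s U = 0"
      from riesz_energy_eq_0_imp_AE[OF that U this] have "AE x in U. False"
      proof eventually_elim
        case (elim x)
        then have "AE y in U. False" using AE_ne[of x] by eventually_elim auto
        then show ?case by simp
      qed
      then show False by simp
    qed
    then show ?thesis using riesz_energy_nonpos[OF that, of U] by simp
  qed
  define t where "t = inverse (r powr (1 / \<alpha>))"
  have t: "t > 0" using r by (simp add: t_def)
  have "moment \<alpha> (dilate t U) = 1"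
    using moment_dilate[OF U, of t \<alpha>] t r \<alpha> inverse_root_powr_mult[of r \<alpha>]
    by (simp add: t_def ennreal_mult[symmetric])
  then have "dilate t U \<in> prob_measures_moment \<alpha> 1"
    using dilate_in_prob_measures[OF U] by (simp add: prob_measures_moment_def)
  moreover have eq: "riesz_energy s (dilate t U) =
      ereal (t powr - s) * riesz_energy s U + ereal (if s = 0 then - ln t else 0)"
    using r by (intro riesz_energy_dilate[OF U \<alpha> _ t]) auto
  have "riesz_energy s (dilate t U) < \<infinity>"
    using efin unfolding eq by (cases "riesz_energy s U") (use t in auto)
  moreover have "riesz_energy s (dilate t U) < 0" if "s < 0"
    using eneg[OF that] that t unfolding eq
    by (cases "riesz_energy s U") (auto simp: mult_pos_neg)
  ultimately show ?thesis by (rule that)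
qed

section \<open>The energy along dilations\<close>

text \<open>
  If \<open>\<nu>\<close> has energy \<open>E\<close> and moment \<open>r\<close>, then this is the energy, including the external field, of
  the dilate of \<open>\<nu>\<close> by the factor \<open>t\<close>.
\<close>
definition dilation_energy :: "real \<Rightarrow> real \<Rightarrow> real \<Rightarrow> real \<Rightarrow> real \<Rightarrow> real \<Rightarrow> real" where
  "dilation_energy s \<gamma> \<alpha> E r t =
    t powr - s * E + (if s = 0 then - ln t else 0) + 2 * \<gamma> / \<alpha> * (t powr \<alpha> * r)"

text \<open>The negative derivative of \<open>t powr - s * E\<close> (or of \<open>E - ln t\<close> if \<open>s = 0\<close>) at \<open>t = 1\<close>.\<close>
definition virial :: "real \<Rightarrow> real \<Rightarrow> real" where
  "virial s E = (if s = 0 then 1 else s * E)"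

text \<open>The right side is minimal at \<tau> = 1. For \<open>s > 0\<close> both powers lie above
  their tangents in \<open>ln \<tau>\<close>, whose linear terms cancel. For \<open>s < 0\<close>
  the first term is negative, and Young's inequality with weights \<open>p / \<alpha>\<close> and
  \<open>1 - p / \<alpha>\<close> compares the two powers.\<close>

lemma powr_div_sum_ge:
  fixes s \<alpha> \<tau> :: real
  assumes "s \<noteq> 0" "max (- s) 0 < \<alpha>" "\<tau> > 0"
  shows "1 / s + 1 / \<alpha> \<le> \<tau> powr - s / s + \<tau> powr \<alpha> / \<alpha>"
proof (cases "s > 0")
  case True
  have 1: "1 + x * ln \<tau> \<le> \<tau> powr x" for x
    using assms(3) exp_ge_add_one_self[of "x * ln \<tau>"] by (simp add: powr_def)
  have "(1 - s * ln \<tau>) / s + (1 + \<alpha> * ln \<tau>) / \<alpha> \<le> \<tau> powr - s / s + \<tau> powr \<alpha> / \<alpha>"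
    using 1[of "- s"] 1[of \<alpha>] True assms by (intro add_mono divide_right_mono) auto
  moreover have "(1 - s * ln \<tau>) / s + (1 + \<alpha> * ln \<tau>) / \<alpha> = 1 / s + 1 / \<alpha>"
    using True assms by (simp add: field_simps)
  ultimately show ?thesis by simp
next
  case False
  define p where "p = - s"
  have p: "0 < p" "p < \<alpha>" using False assms by (auto simp: p_def)
  have "(\<tau> powr \<alpha>) powr (p / \<alpha>) * 1 powr (1 - p / \<alpha>) \<le> p / \<alpha> * \<tau> powr \<alpha> + (1 - p / \<alpha>) * 1"
    using p assms by (intro Youngs_inequality_0) auto
  then have "\<tau> powr p \<le> p / \<alpha> * \<tau> powr \<alpha> + (1 - p / \<alpha>)"
    using p by (simp add: powr_powr)
  then have "\<tau> powr p / p \<le> (p / \<alpha> * \<tau> powr \<alpha> + (1 - p / \<alpha>)) / p"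
    using p by (intro divide_right_mono) auto
  also have "\<dots> = \<tau> powr \<alpha> / \<alpha> + 1 / p - 1 / \<alpha>" using p by (simp add: field_simps)
  finally show ?thesis by (simp add: p_def)
qed

text \<open>The derivative vanishes at an interior minimum.\<close>

lemma dilation_energy_min_imp_virial:
  assumes c: "c > 0" and \<alpha>: "\<alpha> \<noteq> 0"
    and min: "\<And>t. t > 0 \<Longrightarrow> dilation_energy s \<gamma> \<alpha> E r c \<le> dilation_energy s \<gamma> \<alpha> E r t"
  shows "virial s E = 2 * \<gamma> * r * c powr (s + \<alpha>)"
proof -
  have "((\<lambda>t. dilation_energy s \<gamma> \<alpha> E r t) has_real_derivative
      - s * c powr (- s - 1) * E + (if s = 0 then - (1 / c) else 0) +
      2 * \<gamma> / \<alpha> * (\<alpha> * c powr (\<alpha> - 1) * r)) (at c)"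
    unfolding dilation_energy_def
  proof (intro DERIV_add)
    show "((\<lambda>t. t powr - s * E) has_real_derivative - s * c powr (- s - 1) * E) (at c)"
      by (intro DERIV_cmult_right has_real_derivative_powr c)
    show "((\<lambda>t. if s = 0 then - ln t else 0) has_real_derivative
        (if s = 0 then - (1 / c) else 0)) (at c)"
      using c by (auto intro!: derivative_eq_intros)
    show "((\<lambda>t. 2 * \<gamma> / \<alpha> * (t powr \<alpha> * r)) has_real_derivative
        2 * \<gamma> / \<alpha> * (\<alpha> * c powr (\<alpha> - 1) * r)) (at c)"
      by (intro DERIV_cmult DERIV_cmult_right has_real_derivative_powr c)
  qed
  then have "- s * c powr (- s - 1) * E + (if s = 0 then - (1 / c) else 0) +
      2 * \<gamma> / \<alpha> * (\<alpha> * c powr (\<alpha> - 1) * r) = 0"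
    by (rule DERIV_local_min[OF _ c]) (use min c in auto)
  \<comment> \<open>Multiplying by \<open>c powr (s + 1)\<close> clears \<open>c\<close> from the
    first term and turns the last power into \<open>c powr (s + \<alpha>)\<close>.\<close>
  then have "(- s * c powr (- s - 1) * E + (if s = 0 then - (1 / c) else 0) +
      2 * \<gamma> * (c powr (\<alpha> - 1) * r)) * c powr (s + 1) = 0"
    using \<alpha> by simp
  then have "- s * E * (c powr (- s - 1) * c powr (s + 1)) - (if s = 0 then 1 else 0) +
      2 * \<gamma> * r * (c powr (\<alpha> - 1) * c powr (s + 1)) = 0"
    using c by (cases "s = 0") (auto simp: algebra_simps)
  also have "c powr (- s - 1) * c powr (s + 1) = 1"
    using c by (simp add: powr_add[symmetric])
  also have "c powr (\<alpha> - 1) * c powr (s + 1) = c powr (s + \<alpha>)"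
    by (simp add: powr_add[symmetric] add.commute)
  finally show ?thesis
    by (simp add: virial_def split: if_splits)
qed

text \<open>Criticality eliminates \<open>E\<close>. With \<open>t = c * \<tau>\<close> the bracket
  becomes \<open>c powr \<alpha>\<close> times the function bounded in
  \<open>powr_div_sum_ge\<close>.\<close>

lemma dilation_energy_virial:
  assumes "c > 0" "\<alpha> \<noteq> 0" "s \<noteq> 0" "virial s E = 2 * \<gamma> * c powr (s + \<alpha>)"
  shows "dilation_energy s \<gamma> \<alpha> E 1 t =
    2 * \<gamma> * (c powr (s + \<alpha>) * t powr - s / s + t powr \<alpha> / \<alpha>)"
proof -
  have "E = 2 * \<gamma> * c powr (s + \<alpha>) / s" using assms by (simp add: virial_def field_simps)
  then show ?thesis using assms by (simp add: dilation_energy_def field_simps)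
qed

lemma virial_imp_dilation_energy_min:
  assumes c: "c > 0" and \<gamma>: "\<gamma> > 0" and \<alpha>: "max (- s) 0 < \<alpha>"
    and v: "virial s E = 2 * \<gamma> * c powr (s + \<alpha>)" and t: "t > 0"
  shows "dilation_energy s \<gamma> \<alpha> E 1 c \<le> dilation_energy s \<gamma> \<alpha> E 1 t"
proof -
  \<comment> \<open>In the variable \<tau> the minimum sits at 1. For \<open>s = 0\<close> the
    tangent inequality of the exponential then suffices.\<close>
  define \<tau> where "\<tau> = t / c"
  have \<tau>: "\<tau> > 0" "t = c * \<tau>" using c t by (auto simp: \<tau>_def)
  show ?thesis
  proof (cases "s = 0")
    case True
    have cg: "2 * \<gamma> * c powr \<alpha> = 1" using v True by (simp add: virial_def)
    have "1 + \<alpha> * ln \<tau> \<le> \<tau> powr \<alpha>"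
      using \<tau> exp_ge_add_one_self[of "\<alpha> * ln \<tau>"] by (simp add: powr_def)
    then have "(1 + \<alpha> * ln \<tau>) / \<alpha> \<le> \<tau> powr \<alpha> / \<alpha>"
      using \<alpha> by (intro divide_right_mono) auto
    then have "1 / \<alpha> + ln \<tau> \<le> \<tau> powr \<alpha> / \<alpha>"
      using \<alpha> by (simp add: add_divide_distrib)
    moreover have "2 * \<gamma> * t powr \<alpha> = (2 * \<gamma> * c powr \<alpha>) * \<tau> powr \<alpha>"
      using c \<tau> by (simp add: powr_mult)
    then have "2 * \<gamma> * t powr \<alpha> = \<tau> powr \<alpha>" by (simp only: cg)
    ultimately show ?thesis
      using c \<tau>(1) True cg ln_mult_pos[OF c \<tau>(1)] by (simp add: dilation_energy_def \<tau>(2))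
  next
    case False
    have "c powr \<alpha> * (1 / s + 1 / \<alpha>) \<le> c powr \<alpha> * (\<tau> powr - s / s + \<tau> powr \<alpha> / \<alpha>)"
      using powr_div_sum_ge[OF False \<alpha> \<tau>(1)] by (intro mult_left_mono) auto
    moreover have "c powr (s + \<alpha>) * c powr - s = c powr \<alpha>" by (simp add: powr_add[symmetric])
    then have "c powr (s + \<alpha>) * c powr - s / s + c powr \<alpha> / \<alpha> = c powr \<alpha> * (1 / s + 1 / \<alpha>)"
      "c powr (s + \<alpha>) * t powr - s / s + t powr \<alpha> / \<alpha> = c powr \<alpha> * (\<tau> powr - s / s + \<tau> powr \<alpha> / \<alpha>)"
      using c \<tau> by (simp_all add: powr_mult distrib_left)
    ultimately show ?thesis
      using dilation_energy_virial[OF c _ False v] \<alpha> \<gamma> by simp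
  qed
qed

text \<open>The critical value is a positive multiple of \<open>1 / s + 1 / \<alpha>\<close>,
  negative since \<open>- s < \<alpha>\<close>. It lies below the value 0 taken by the Dirac mass at
  the origin for \<open>s < 0\<close>.\<close>

lemma dilation_energy_neg:
  assumes c: "c > 0" and \<gamma>: "\<gamma> > 0" and \<alpha>: "max (- s) 0 < \<alpha>" and s: "s < 0"
    and v: "virial s E = 2 * \<gamma> * c powr (s + \<alpha>)"
  shows "dilation_energy s \<gamma> \<alpha> E 1 c < 0"
proof -
  have "c powr (s + \<alpha>) * c powr - s = c powr \<alpha>" by (simp add: powr_add[symmetric])
  then have "dilation_energy s \<gamma> \<alpha> E 1 c = 2 * \<gamma> * c powr \<alpha> * (1 / s + 1 / \<alpha>)"
    using dilation_energy_virial[OF c _ _ v] s \<alpha> by (simp add: distrib_left)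
  moreover have "1 / s + 1 / \<alpha> < 0" using s \<alpha> frac_less2[of 1 1 "- s" \<alpha>] by simp
  ultimately show ?thesis using c \<gamma> by (simp add: mult_pos_neg)
qed

lemma virial_scale:
  assumes "\<gamma> > 0" "virial s E > 0" "s + \<alpha> > 0"
  defines "c \<equiv> (virial s E / (2 * \<gamma>)) powr (1 / (s + \<alpha>))"
  shows "c > 0" "virial s E = 2 * \<gamma> * c powr (s + \<alpha>)"
  using assms by (auto simp: powr_powr)

section \<open>Minimizers\<close>

text \<open>Joins the two prescribed scales, so that all \<open>s\<close> are treated at once. The
  formula \<open>equilibrium_scale\<close> alone would give 0 at \<open>s = 0\<close>.\<close>

definition field_scale :: "real \<Rightarrow> real \<Rightarrow> real \<Rightarrow> 'a::euclidean_space measure \<Rightarrow> real" where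
  "field_scale s \<gamma> \<alpha> \<nu> =
    (if s = 0 then (1 / (2 * \<gamma>)) powr (1 / \<alpha>) else equilibrium_scale s \<gamma> \<alpha> \<nu>)"

lemma field_scale_eq:
  assumes "riesz_energy s \<nu> = ereal E"
  shows "field_scale s \<gamma> \<alpha> \<nu> = (virial s E / (2 * \<gamma>)) powr (1 / (s + \<alpha>))"
  using assms by (simp add: field_scale_def equilibrium_scale_def virial_def)

lemma minimizes_over_iff:
  "minimizes_over E S \<mu> \<longleftrightarrow> \<mu> \<in> S \<and> (\<forall>\<mu>'\<in>S. E \<mu> \<le> E \<mu>')"
  by (auto simp: minimizes_over_def is_arg_min_def not_less)

lemma prob_measures_moment_1_iff:
  "\<nu> \<in> prob_measures_moment \<alpha> 1 \<longleftrightarrow> \<nu> \<in> prob_measures \<and> moment \<alpha> \<nu> = 1"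
  by (simp add: prob_measures_moment_def)

section \<open>Comparison of the two minimization problems\<close>

context
  fixes s \<gamma> \<alpha> :: real and T :: "'a::euclidean_space itself"
  assumes s: "s < DIM('a)" and \<gamma>: "\<gamma> > 0" and \<alpha>: "max (- s) 0 < \<alpha>"
begin

abbreviation (input) "field_energy \<equiv> (riesz_energy_field s (power_field \<gamma> \<alpha>) :: 'a measure \<Rightarrow> ereal)"

abbreviation (input) "field_min \<equiv> minimizes_over field_energy prob_measures"

abbreviation (input) "moment_min \<equiv>
  (minimizes_over (riesz_energy s) (prob_measures_moment \<alpha> 1) :: 'a measure \<Rightarrow> bool)"

lemma field_energy_dilate:
  assumes \<nu>: "\<nu> \<in> prob_measures" and r: "moment \<alpha> \<nu> = ennreal r" "r \<ge> 0"
    and E: "riesz_energy s \<nu> = ereal E" and t: "t > 0"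
  shows "field_energy (dilate t \<nu>) = ereal (dilation_energy s \<gamma> \<alpha> E r t)"
proof -
  have "moment \<alpha> (dilate t \<nu>) = ennreal (t powr \<alpha> * r)"
    using moment_dilate[OF \<nu>, of t \<alpha>] r t by (simp add: ennreal_mult)
  then show ?thesis
    using riesz_energy_field_finite_moment[OF dilate_in_prob_measures[OF \<nu>] \<alpha> \<gamma>, of t "t powr \<alpha> * r"]
      riesz_energy_dilate[OF \<nu> \<alpha> _ t] r E t
    by (simp add: dilation_energy_def)
qed

lemma finite_moment_energy_obtain:
  assumes "\<nu> \<in> prob_measures_moment \<alpha> 1" "riesz_energy s \<nu> < \<infinity>"
  obtains E where "riesz_energy s \<nu> = ereal E"
  using assms riesz_energy_not_MInf[of \<nu> s \<alpha>] \<alpha>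
  by (cases "riesz_energy s \<nu>") (auto simp: prob_measures_moment_1_iff)

text \<open>Measures of infinite moment or infinite interaction energy are excluded since finite values
  occur, and the Dirac mass at the origin since its energy is infinite or, for \<open>s < 0\<close>, vanishes
  whereas negative values occur.\<close>
lemma field_min_obtain:
  assumes "field_min \<mu>"
  obtains r E where "r > 0" "moment \<alpha> \<mu> = ennreal r" "riesz_energy s \<mu> = ereal E"
proof -
  have \<mu>: "\<mu> \<in> prob_measures" and le: "\<And>\<mu>'. \<mu>' \<in> prob_measures \<Longrightarrow> field_energy \<mu> \<le> field_energy \<mu>'"
    using assms by (auto simp: minimizes_over_iff)
  obtain \<nu> :: "'a measure" where \<nu>: "\<nu> \<in> prob_measures_moment \<alpha> 1" "riesz_energy s \<nu> < \<infinity>"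
    "s < 0 \<Longrightarrow> riesz_energy s \<nu> < 0"
    using exists_finite_riesz_energy[OF s \<alpha>] by blast
  obtain E0 where E0: "riesz_energy s \<nu> = ereal E0" using finite_moment_energy_obtain[OF \<nu>(1,2)] .
  have \<nu>P: "\<nu> \<in> prob_measures" "moment \<alpha> \<nu> = ennreal 1"
    using \<nu>(1) by (auto simp: prob_measures_moment_1_iff)
  have le': "field_energy \<mu> \<le> ereal (dilation_energy s \<gamma> \<alpha> E0 1 t)" if "t > 0" for t
    using le[OF dilate_in_prob_measures[OF \<nu>P(1)], of t] field_energy_dilate[OF \<nu>P _ E0 that] by simp
  have fin: "field_energy \<mu> < \<infinity>" using le'[of 1] by (auto intro: le_less_trans)
  then have "moment \<alpha> \<mu> \<noteq> \<infinity>"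
    using riesz_energy_field_infinite_moment[OF \<mu> \<alpha> \<gamma>] by auto
  then obtain r where r: "moment \<alpha> \<mu> = ennreal r" "r \<ge> 0"
    by (cases "moment \<alpha> \<mu>") auto
  have J: "field_energy \<mu> = riesz_energy s \<mu> + ereal (2 * \<gamma> / \<alpha> * r)"
    by (rule riesz_energy_field_finite_moment[OF \<mu> \<alpha> \<gamma> r])
  then obtain E where E: "riesz_energy s \<mu> = ereal E"
    using fin riesz_energy_not_MInf[OF \<mu> \<alpha>] r by (cases "riesz_energy s \<mu>") auto
  have "r \<noteq> 0"
  proof
    assume "r = 0"
    then have "riesz_energy s \<mu> = (if s < 0 then 0 else \<infinity>)"
      using riesz_energy_zero_moment[OF \<mu>] r by simp
    then have neg: "s < 0" and "field_energy \<mu> = 0"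
      using E J \<open>r = 0\<close> by (auto split: if_splits)
    \<comment> \<open>The critical scale for \<open>E0\<close> yields a dilate of \<nu> with
      negative energy, contradicting the value 0 at \<mu>.\<close>
    moreover have "virial s E0 > 0"
      using \<nu>(3)[OF neg] neg E0 by (simp add: virial_def mult_neg_neg)
    ultimately show False
      using le' virial_scale[OF \<gamma>, of s E0 \<alpha>] dilation_energy_neg[OF _ \<gamma> \<alpha> neg] \<alpha> by fastforce
  qed
  then show ?thesis using that r E by simp
qed

text \<open>Comparison with all dilates of \<nu> gives criticality at \<open>c\<close>. If
  \<open>r = 1\<close>, comparison with the dilates by \<open>c\<close> of other measures of unit
  moment gives minimality of \<nu>. The moment \<open>r\<close> is left free because it is only
  determined later from the scale.\<close>

lemma field_min_dilateD:
  assumes \<nu>: "\<nu> \<in> prob_measures" and c: "c > 0" and min: "field_min (dilate c \<nu>)"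
  obtains r E where "r > 0" "moment \<alpha> \<nu> = ennreal r" "riesz_energy s \<nu> = ereal E"
    "virial s E = 2 * \<gamma> * r * c powr (s + \<alpha>)" "r = 1 \<longrightarrow> moment_min \<nu>"
proof -
  let ?\<mu> = "dilate c \<nu>"
  have \<mu>: "?\<mu> \<in> prob_measures" and le: "\<And>\<mu>'. \<mu>' \<in> prob_measures \<Longrightarrow> field_energy ?\<mu> \<le> field_energy \<mu>'"
    using min by (auto simp: minimizes_over_iff)
  obtain q F where q: "q > 0" "moment \<alpha> ?\<mu> = ennreal q" and F: "riesz_energy s ?\<mu> = ereal F"
    using field_min_obtain[OF min] .
  \<comment> \<open>Finiteness and positivity are known for the dilate, and pass to \<nu> by
    dilating back.\<close>
  have \<nu>_eq: "\<nu> = dilate (inverse c) ?\<mu>"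
    using c \<nu> by (simp add: dilate_dilate dilate_1)
  define r where "r = inverse c powr \<alpha> * q"
  have r: "r > 0" "moment \<alpha> \<nu> = ennreal r"
    using moment_dilate[OF \<mu>, of "inverse c" \<alpha>] c q by (auto simp: r_def \<nu>_eq[symmetric] ennreal_mult)
  obtain E where E: "riesz_energy s \<nu> = ereal E"
    using riesz_energy_dilate[OF \<mu> \<alpha>, of "inverse c"] c q F by (auto simp: \<nu>_eq[symmetric])
  have Jt: "field_energy (dilate t \<nu>) = ereal (dilation_energy s \<gamma> \<alpha> E r t)" if "t > 0" for t
    using field_energy_dilate[OF \<nu> r(2) _ E that] r(1) by simp
  have "virial s E = 2 * \<gamma> * r * c powr (s + \<alpha>)"
  proof (rule dilation_energy_min_imp_virial[OF c])
    show "dilation_energy s \<gamma> \<alpha> E r c \<le> dilation_energy s \<gamma> \<alpha> E r t" if "t > 0" for t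
      using le[OF dilate_in_prob_measures[OF \<nu>], of t] Jt c that by simp
  qed (use \<alpha> in auto)
  moreover have "moment_min \<nu>" if "r = 1"
    unfolding minimizes_over_iff
  proof (intro conjI ballI)
    show "\<nu> \<in> prob_measures_moment \<alpha> 1"
      using \<nu> r that by (simp add: prob_measures_moment_1_iff)
    fix \<nu>' :: "'a measure" assume \<nu>': "\<nu>' \<in> prob_measures_moment \<alpha> 1"
    show "riesz_energy s \<nu> \<le> riesz_energy s \<nu>'"
    proof (cases "riesz_energy s \<nu>' < \<infinity>")
      case True
      then obtain E' where E': "riesz_energy s \<nu>' = ereal E'"
        using finite_moment_energy_obtain[OF \<nu>'] by blast
      have "\<nu>' \<in> prob_measures" "moment \<alpha> \<nu>' = ennreal 1"
        using \<nu>' by (auto simp: prob_measures_moment_1_iff)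
      \<comment> \<open>Scale and moment agree on both sides, so the two values differ only through
        \<open>E\<close> and \<open>E'\<close>.\<close>
      then have "dilation_energy s \<gamma> \<alpha> E 1 c \<le> dilation_energy s \<gamma> \<alpha> E' 1 c"
        using le[OF dilate_in_prob_measures, of \<nu>' c] Jt[OF c] that
          field_energy_dilate[of \<nu>' 1 E' c] E' c by simp
      then show ?thesis using c E E' by (simp add: dilation_energy_def)
    qed simp
  qed
  ultimately show ?thesis using that r E by blast
qed

text \<open>A competitor of positive finite moment is a dilate by some \<open>t\<close> of a measure
  of unit moment. Its energy does not increase when the energy at unit moment is lowered to
  \<open>E\<close>, and then when \<open>t\<close> is replaced by the critical scale.\<close>

lemma moment_minD:
  assumes "moment_min \<nu>"
  shows "field_min (dilate (field_scale s \<gamma> \<alpha> \<nu>) \<nu>)"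
proof -
  have \<nu>: "\<nu> \<in> prob_measures_moment \<alpha> 1"
    and le: "\<And>\<nu>' :: 'a measure. \<nu>' \<in> prob_measures_moment \<alpha> 1 \<Longrightarrow> riesz_energy s \<nu> \<le> riesz_energy s \<nu>'"
    using assms by (auto simp: minimizes_over_iff)
  then have \<nu>P: "\<nu> \<in> prob_measures" "moment \<alpha> \<nu> = ennreal 1"
    by (auto simp: prob_measures_moment_1_iff)
  obtain \<nu>0 :: "'a measure" where \<nu>0: "\<nu>0 \<in> prob_measures_moment \<alpha> 1" "riesz_energy s \<nu>0 < \<infinity>"
    "s < 0 \<Longrightarrow> riesz_energy s \<nu>0 < 0"
    using exists_finite_riesz_energy[OF s \<alpha>] by blast
  have "riesz_energy s \<nu> < \<infinity>" using le[OF \<nu>0(1)] \<nu>0(2) by (rule le_less_trans)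
  then obtain E where E: "riesz_energy s \<nu> = ereal E"
    using finite_moment_energy_obtain[OF \<nu>] by blast
  have neg: "riesz_energy s \<nu> < 0" if "s < 0" using le[OF \<nu>0(1)] \<nu>0(3)[OF that] by (rule le_less_trans)
  \<comment> \<open>The energy has the sign of \<open>s\<close> for nonzero \<open>s\<close>; for
    \<open>s = 0\<close> the virial is 1.\<close>
  have v: "virial s E > 0"
    using riesz_energy_pos[OF _ \<nu>P(1), of s] neg E
    by (auto simp: virial_def mult_neg_neg neq_iff)
  define c where "c = field_scale s \<gamma> \<alpha> \<nu>"
  have c: "c > 0" "virial s E = 2 * \<gamma> * c powr (s + \<alpha>)"
    using virial_scale[OF \<gamma> v, of \<alpha>] field_scale_eq[OF E] \<alpha> by (auto simp: c_def)
  have Jc: "field_energy (dilate c \<nu>) = ereal (dilation_energy s \<gamma> \<alpha> E 1 c)"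
    using field_energy_dilate[OF \<nu>P _ E c(1)] by simp
  have "field_energy (dilate c \<nu>) \<le> field_energy \<mu>" if \<mu>: "\<mu> \<in> prob_measures" for \<mu>
  proof (cases "field_energy \<mu> = \<infinity>")
    case False
    then have "moment \<alpha> \<mu> \<noteq> \<infinity>"
      using riesz_energy_field_infinite_moment[OF \<mu> \<alpha> \<gamma>] by auto
    then obtain r where r: "moment \<alpha> \<mu> = ennreal r" "r \<ge> 0"
      by (cases "moment \<alpha> \<mu>") auto
    have J: "field_energy \<mu> = riesz_energy s \<mu> + ereal (2 * \<gamma> / \<alpha> * r)"
      by (rule riesz_energy_field_finite_moment[OF \<mu> \<alpha> \<gamma> r])
    show ?thesis
    proof (cases "r = 0")
      case True
      then have "riesz_energy s \<mu> = (if s < 0 then 0 else \<infinity>)"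
        using riesz_energy_zero_moment[OF \<mu>] r by simp
      then have "s < 0" "field_energy \<mu> = 0"
        using False J True by (auto split: if_splits)
      then show ?thesis using dilation_energy_neg[OF c(1) \<gamma> \<alpha> _ c(2)] Jc by simp
    next
      case r0: False
      \<comment> \<open>\<open>t\<close> is the radius of \<mu>, so dividing by it produces unit
        moment.\<close>
      define t where "t = r powr (1 / \<alpha>)"
      have t: "t > 0" "inverse t powr \<alpha> * r = 1"
        using r r0 \<alpha> inverse_root_powr_mult[of r \<alpha>] by (auto simp: t_def)
      let ?\<nu> = "dilate (inverse t) \<mu>"
      have \<nu>': "?\<nu> \<in> prob_measures" "moment \<alpha> ?\<nu> = ennreal 1"
        using dilate_in_prob_measures[OF \<mu>] moment_dilate[OF \<mu>, of "inverse t" \<alpha>] t r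
        by (auto simp: ennreal_mult[symmetric])
      have "riesz_energy s ?\<nu> < \<infinity>"
        using riesz_energy_dilate[OF \<mu> \<alpha>, of "inverse t"] t r J False
        by (cases "riesz_energy s \<mu>") auto
      moreover have \<nu>'1: "?\<nu> \<in> prob_measures_moment \<alpha> 1" using \<nu>' by (simp add: prob_measures_moment_1_iff)
      ultimately obtain E' where E': "riesz_energy s ?\<nu> = ereal E'"
        using finite_moment_energy_obtain by blast
      have "dilation_energy s \<gamma> \<alpha> E 1 c \<le> dilation_energy s \<gamma> \<alpha> E 1 t"
        by (rule virial_imp_dilation_energy_min[OF c(1) \<gamma> \<alpha> c(2) t(1)])
      also have "\<dots> \<le> dilation_energy s \<gamma> \<alpha> E' 1 t"
        using le[OF \<nu>'1] E E' by (simp add: dilation_energy_def mult_left_mono)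
      finally show ?thesis
        using field_energy_dilate[OF \<nu>' _ E' t(1)] Jc t(1) \<mu> by (simp add: dilate_dilate dilate_1)
    qed
  qed simp
  then show ?thesis
    using dilate_in_prob_measures[OF \<nu>P(1)] by (auto simp: minimizes_over_iff c_def)
qed

text \<open>For the converse, criticality contains the unknown moment \<open>r\<close> as a factor,
  while the definition of the scale is the same equation with \<open>r = 1\<close>. Comparing the
  two gives the moment constraint.\<close>

lemma moment_min_iff_field_min:
  assumes \<nu>: "\<nu> \<in> prob_measures"
  shows "moment_min \<nu> \<longleftrightarrow> field_min (dilate (field_scale s \<gamma> \<alpha> \<nu>) \<nu>)"
proof
  assume min: "field_min (dilate (field_scale s \<gamma> \<alpha> \<nu>) \<nu>)"
  define c where "c = field_scale s \<gamma> \<alpha> \<nu>"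
  \<comment> \<open>The scale is 0 when its base vanishes, for instance for infinite energy; the
    dilate is then the Dirac mass at the origin, which is not a minimizer.\<close>
  have "c \<noteq> 0"
  proof
    assume "c = 0"
    then have "moment \<alpha> (dilate c \<nu>) = 0" using moment_dilate[OF \<nu>, of c \<alpha>] by simp
    then show False using field_min_obtain[OF min] by (auto simp: c_def ennreal_eq_0_iff)
  qed
  then have c: "c > 0" by (simp add: c_def field_scale_def equilibrium_scale_def split: if_splits)
  obtain r E where rE: "r > 0" "moment \<alpha> \<nu> = ennreal r" "riesz_energy s \<nu> = ereal E"
    "virial s E = 2 * \<gamma> * r * c powr (s + \<alpha>)" "r = 1 \<longrightarrow> moment_min \<nu>"
    using field_min_dilateD[OF \<nu> c min[folded c_def]] .
  have "virial s E > 0" using rE(1,4) \<gamma> c by simp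
  then have "virial s E = 2 * \<gamma> * c powr (s + \<alpha>)"
    using virial_scale(2)[OF \<gamma>, of s E \<alpha>] field_scale_eq[OF rE(3)] \<alpha> by (simp add: c_def)
  then have "r = 1" using rE(4) \<gamma> c by simp
  then show "moment_min \<nu>" by (rule rE(5)[rule_format])
qed (rule moment_minD)

text \<open>Normalization fixes \<open>r = 1\<close>, so criticality solved for \<open>c\<close> is
  the condition on the scale; with this condition the converse is
  \<open>moment_minD\<close>.\<close>

lemma field_min_iff_moment_min:
  assumes \<mu>: "\<mu> \<in> prob_measures"
  defines "c \<equiv> moment_radius \<alpha> \<mu>"
  defines "\<nu> \<equiv> dilate (inverse c) \<mu>"
  shows "field_min \<mu> \<longleftrightarrow> moment_min \<nu> \<and> c = field_scale s \<gamma> \<alpha> \<nu>"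
proof -
  have \<nu>P: "\<nu> \<in> prob_measures" using dilate_in_prob_measures[OF \<mu>] by (simp add: \<nu>_def)
  have dilate_c: "dilate c \<nu> = \<mu>" if "c > 0"
    using \<mu> that by (simp add: \<nu>_def dilate_dilate dilate_1)
  have c0: "c \<ge> 0" by (simp add: c_def moment_radius_def)
  show ?thesis
  proof
    assume min: "field_min \<mu>"
    obtain q where q: "q > 0" "moment \<alpha> \<mu> = ennreal q" using field_min_obtain[OF min] by blast
    note [measurable_cong] = prob_measuresD(2)[OF \<mu>]
    have "(\<integral>x. norm x powr \<alpha> \<partial>\<mu>) = q"
      using q by (subst integral_eq_nn_integral) auto
    then have cq: "c = q powr (1 / \<alpha>)" by (simp add: c_def moment_radius_def)
    then have c: "c > 0" using q by simp
    have min': "field_min (dilate c \<nu>)" using min dilate_c[OF c] by simp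
    obtain r E where rE: "r > 0" "moment \<alpha> \<nu> = ennreal r" "riesz_energy s \<nu> = ereal E"
      "virial s E = 2 * \<gamma> * r * c powr (s + \<alpha>)" "r = 1 \<longrightarrow> moment_min \<nu>"
      using field_min_dilateD[OF \<nu>P c min'] .
    have "moment \<alpha> \<nu> = ennreal (inverse c powr \<alpha> * q)"
      using moment_dilate[OF \<mu>, of "inverse c" \<alpha>] c q by (simp add: \<nu>_def ennreal_mult)
    moreover have "inverse c powr \<alpha> * q = 1"
      using q \<alpha> inverse_root_powr_mult[of q \<alpha>] by (simp add: cq)
    ultimately have r: "r = 1" using rE(1,2) by simp
    then have "c powr (s + \<alpha>) = virial s E / (2 * \<gamma>)" using rE(4) \<gamma> by simp
    then have "field_scale s \<gamma> \<alpha> \<nu> = (c powr (s + \<alpha>)) powr (1 / (s + \<alpha>))"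
      using field_scale_eq[OF rE(3)] by simp
    then show "moment_min \<nu> \<and> c = field_scale s \<gamma> \<alpha> \<nu>"
      using rE(5) r c \<alpha> by (simp add: powr_powr)
  next
    assume "moment_min \<nu> \<and> c = field_scale s \<gamma> \<alpha> \<nu>"
    then have min: "moment_min \<nu>" and c: "c = field_scale s \<gamma> \<alpha> \<nu>" by auto
    \<comment> \<open>Since \<open>inverse 0 = 0\<close>, a vanishing radius would make \<nu> the
      Dirac mass at the origin, against its unit moment. This also covers an infinite moment of
      \<mu>, where the Bochner integral is 0.\<close>
    have "c \<noteq> 0"
    proof
      assume "c = 0"
      then have "moment \<alpha> \<nu> = 0"
        using moment_dilate[OF \<mu>, of 0 \<alpha>] by (simp add: \<nu>_def)
      then show False using min by (simp add: minimizes_over_iff prob_measures_moment_1_iff)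
    qed
    then show "field_min \<mu>" using moment_minD[OF min] dilate_c c0 c by simp
  qed
qed

end

theorem proposition1p5:
  fixes s \<gamma> \<alpha> :: real
    and V :: "real ^ 'd \<Rightarrow> real"
  assumes "CARD('d) \<ge> 2"
    and "\<gamma> > 0"
    and "\<alpha> > max (- s) 0"
    and "V = power_field \<gamma> \<alpha>"
  shows "(s < real CARD('d) \<and> s \<noteq> 0 \<longrightarrow>
      (\<forall>\<nu> \<in> prob_measures.
         let c = equilibrium_scale s \<gamma> \<alpha> \<nu>; \<mu> = dilate c \<nu> in
         minimizes_over (riesz_energy s) (prob_measures_moment \<alpha> 1) \<nu> \<longleftrightarrow>
         minimizes_over (riesz_energy_field s V) prob_measures \<mu>) \<and>
      (\<forall>\<mu> \<in> prob_measures.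
         let c = moment_radius \<alpha> \<mu>; \<nu> = dilate (inverse c) \<mu> in
         minimizes_over (riesz_energy_field s V) prob_measures \<mu> \<longleftrightarrow>
         minimizes_over (riesz_energy s) (prob_measures_moment \<alpha> 1) \<nu> \<and>
         c = equilibrium_scale s \<gamma> \<alpha> \<nu>)) \<and>
    (s = 0 \<longrightarrow>
      (\<forall>\<nu> \<in> prob_measures.
         let c = (1 / (2 * \<gamma>)) powr (1 / \<alpha>); \<mu> = dilate c \<nu> in
         minimizes_over (riesz_energy 0) (prob_measures_moment \<alpha> 1) \<nu> \<longleftrightarrow>
         minimizes_over (riesz_energy_field 0 V) prob_measures \<mu>) \<and>
      (\<forall>\<mu> \<in> prob_measures.
         let c = moment_radius \<alpha> \<mu>; \<nu> = dilate (inverse c) \<mu> in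
         minimizes_over (riesz_energy_field 0 V) prob_measures \<mu> \<longleftrightarrow>
         minimizes_over (riesz_energy 0) (prob_measures_moment \<alpha> 1) \<nu> \<and>
         c = (1 / (2 * \<gamma>)) powr (1 / \<alpha>)))"
proof -
  have \<alpha>: "max (- s) 0 < \<alpha>" using assms(3) by simp
  have scale: "field_scale s \<gamma> \<alpha> = (equilibrium_scale s \<gamma> \<alpha> :: (real ^ 'd) measure \<Rightarrow> real)" if "s \<noteq> 0"
    using that by (simp add: field_scale_def fun_eq_iff)
  have scale0: "field_scale 0 \<gamma> \<alpha> = (\<lambda>_ :: (real ^ 'd) measure. (1 / (2 * \<gamma>)) powr (1 / \<alpha>))"
    by (simp add: field_scale_def fun_eq_iff)
  have dim: "s < real DIM(real ^ 'd)" if "s < real CARD('d)" using that by simp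
  show ?thesis
    unfolding Let_def assms(4)
  proof (intro conjI impI ballI; (elim conjE)?)
    fix \<nu> :: "(real ^ 'd) measure"
    assume s: "s < real CARD('d)" "s \<noteq> 0" and \<nu>: "\<nu> \<in> prob_measures"
    show "minimizes_over (riesz_energy s) (prob_measures_moment \<alpha> 1) \<nu> \<longleftrightarrow>
      minimizes_over (riesz_energy_field s (power_field \<gamma> \<alpha>)) prob_measures
        (dilate (equilibrium_scale s \<gamma> \<alpha> \<nu>) \<nu>)"
      using moment_min_iff_field_min[OF dim[OF s(1)] assms(2) \<alpha> \<nu>] scale[OF s(2)] by simp
  next
    fix \<mu> :: "(real ^ 'd) measure"
    assume s: "s < real CARD('d)" "s \<noteq> 0" and \<mu>: "\<mu> \<in> prob_measures"
    show "minimizes_over (riesz_energy_field s (power_field \<gamma> \<alpha>)) prob_measures \<mu> \<longleftrightarrow>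
      minimizes_over (riesz_energy s) (prob_measures_moment \<alpha> 1)
        (dilate (inverse (moment_radius \<alpha> \<mu>)) \<mu>) \<and>
      moment_radius \<alpha> \<mu> = equilibrium_scale s \<gamma> \<alpha> (dilate (inverse (moment_radius \<alpha> \<mu>)) \<mu>)"
      using field_min_iff_moment_min[OF dim[OF s(1)] assms(2) \<alpha> \<mu>] scale[OF s(2)] by simp
  next
    fix \<nu> :: "(real ^ 'd) measure"
    assume s: "s = 0" and \<nu>: "\<nu> \<in> prob_measures"
    show "minimizes_over (riesz_energy 0) (prob_measures_moment \<alpha> 1) \<nu> \<longleftrightarrow>
      minimizes_over (riesz_energy_field 0 (power_field \<gamma> \<alpha>)) prob_measures
        (dilate ((1 / (2 * \<gamma>)) powr (1 / \<alpha>)) \<nu>)"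
      using moment_min_iff_field_min[OF _ assms(2) _ \<nu>, of 0 \<alpha>] \<alpha> s scale0 by simp
  next
    fix \<mu> :: "(real ^ 'd) measure"
    assume s: "s = 0" and \<mu>: "\<mu> \<in> prob_measures"
    show "minimizes_over (riesz_energy_field 0 (power_field \<gamma> \<alpha>)) prob_measures \<mu> \<longleftrightarrow>
      minimizes_over (riesz_energy 0) (prob_measures_moment \<alpha> 1)
        (dilate (inverse (moment_radius \<alpha> \<mu>)) \<mu>) \<and>
      moment_radius \<alpha> \<mu> = (1 / (2 * \<gamma>)) powr (1 / \<alpha>)"
      using field_min_iff_moment_min[OF _ assms(2) _ \<mu>, of 0 \<alpha>] \<alpha> s scale0 by simp
  qed
qed

end
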